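(* Let $\phi\in L^2(\mathbb{R}^d)$, $\phi\ne0$, let $\Phi=|\hat\phi|^2$, and let $\{\lambda_k\}_{k\in\mathbb{Z}}$ be a sequence in $\mathbb{R}^d$. If $$\|\phi\|_{L^2(\mathbb{R}^d)}^2>\sup_{j\in\mathbb{Z}}\ \sum_{l\in\mathbb{Z},\,l\ne j}\left|\hat\Phi(\lambda_j-\lambda_l)\right|,$$ then the system of translates $\{T_{\lambda_k}\phi\}_{k\in\mathbb{Z}}$ is a Riesz sequence.
   Context: Fourier transform: $\hat f(w)=\int_{\mathbb{R}^d}f(x)e^{-2\pi i x\cdot w}\,dx$, extended to $L^2(\mathbb{R}^d)$; $\Phi\in L^1(\mathbb{R}^d)$, so $\hat\Phi$ is given by the integral pointwise. $T_\lambda f(x)=f(x-\lambda)$. A sequence $\{\psi_k\}$ in a Hilbert space is a Riesz sequence if it is a Riesz basis for its closed linear span, i.e. there exist $0<A\le B$ with $A\sum|c_k|^2\le\|\sum c_k\psi_k\|^2\le B\sum|c_k|^2$ for all finite scalar sequences $\{c_k\}$. *)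

theory Defs
  imports "HOL-Analysis.Analysis"
begin

text \<open>
  Elements of $L^1$ and $L^2$ are represented by Lebesgue measurable complex-valued functions;
  equality in $L^2$ is equality almost everywhere.
\<close>

definition L1_space :: "('a::euclidean_space \<Rightarrow> complex) set" where
  "L1_space = {f. integrable lebesgue f}"

definition L2_space :: "('a::euclidean_space \<Rightarrow> complex) set" where
  "L2_space = {f \<in> borel_measurable lebesgue. integrable lebesgue (\<lambda>x. (cmod (f x))\<^sup>2)}"

text \<open>Meaningful for members of \<open>L2_space\<close> only: Bochner integrals default to 0.\<close>

definition L2_norm :: "('a::euclidean_space \<Rightarrow> complex) \<Rightarrow> real" where
  "L2_norm f = sqrt (LINT x|lebesgue. (cmod (f x))\<^sup>2)"

definition fourier :: "('a::euclidean_space \<Rightarrow> complex) \<Rightarrow> 'a \<Rightarrow> complex" where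
  "fourier f w = (LINT x|lebesgue. f x * exp (- 2 * of_real pi * \<i> * of_real (x \<bullet> w)))"

text \<open>
  The extension by continuity of \<^const>\<open>fourier\<close> from $L^1 \cap L^2$ to $L^2$.
  It is determined up to null sets only, so it is introduced as a relation between
  representatives, from which \<open>fourier_L2\<close> selects one.
\<close>

definition is_fourier_L2 ::
    "('a::euclidean_space \<Rightarrow> complex) \<Rightarrow> ('a \<Rightarrow> complex) \<Rightarrow> bool" where
  "is_fourier_L2 f g \<longleftrightarrow> f \<in> L2_space \<and> g \<in> L2_space \<and>
     (\<exists>u. (\<forall>n. u n \<in> L1_space \<inter> L2_space \<and> fourier (u n) \<in> L2_space) \<and>
          (\<lambda>n::nat. L2_norm (\<lambda>x. u n x - f x)) \<longlonglongrightarrow> 0 \<and>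
          (\<lambda>n. L2_norm (\<lambda>w. fourier (u n) w - g w)) \<longlonglongrightarrow> 0)"

definition fourier_L2 :: "('a::euclidean_space \<Rightarrow> complex) \<Rightarrow> 'a \<Rightarrow> complex" where
  "fourier_L2 f = (SOME g. is_fourier_L2 f g)"

definition translate :: "'a::euclidean_space \<Rightarrow> ('a \<Rightarrow> complex) \<Rightarrow> 'a \<Rightarrow> complex" where
  "translate a f = (\<lambda>x. f (x - a))"

definition riesz_sequence :: "('i \<Rightarrow> 'a::euclidean_space \<Rightarrow> complex) \<Rightarrow> bool" where
  "riesz_sequence \<psi> \<longleftrightarrow> (\<forall>k. \<psi> k \<in> L2_space) \<and>
     (\<exists>A B. 0 < A \<and> A \<le> B \<and>
        (\<forall>K (c :: 'i \<Rightarrow> complex). finite K \<longrightarrow>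
           A * (\<Sum>k\<in>K. (cmod (c k))\<^sup>2) \<le> (L2_norm (\<lambda>x. \<Sum>k\<in>K. c k * \<psi> k x))\<^sup>2 \<and>
           (L2_norm (\<lambda>x. \<Sum>k\<in>K. c k * \<psi> k x))\<^sup>2 \<le> B * (\<Sum>k\<in>K. (cmod (c k))\<^sup>2)))"

end

theory Submission
  imports Defs "HOL-Probability.Probability"
begin

text \<open>
  By Plancherel's theorem the inner product of the translates of \<open>\<phi>\<close> by \<open>\<lambda>\<^sub>j\<close> and \<open>\<lambda>\<^sub>k\<close> is the
  Fourier transform of \<open>\<Phi>\<close> at \<open>\<lambda>\<^sub>j - \<lambda>\<^sub>k\<close>.  The Gram matrix thus has the constant diagonal
  \<open>N = \<parallel>\<phi>\<parallel>\<^sup>2\<close>, and its off-diagonal row sums are at most some \<open>S < N\<close>.  As it is Hermitian, its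
  quadratic form lies between \<open>N - S\<close> and \<open>N + S\<close> times the square norm of the coefficients.

  Plancherel's theorem for \<open>u\<close> in \<open>L\<^sup>1 \<inter> L\<^sup>2\<close> is obtained by damping the square of the absolute
  value of its transform with a wide Gaussian: Fubini's theorem turns the integral into an average
  of the autocorrelation \<open>z \<mapsto> \<integral> u(x) u(x - z)\<^sup>* dx\<close> against a narrow Gaussian, and the
  autocorrelation is continuous at \<open>0\<close>.
\<close>

section \<open>Square integrable functions\<close>

text \<open>Plancherel is formally Fourier inversion at 0 for the autocorrelation, whose transform
  is the squared modulus of the transform of \<open>u\<close>. For \<open>u\<close> in L1 and L2
  that squared modulus is at first known only to be bounded, so the inversion integral is not yet
  available. The Gaussian supplies the missing integrability, and monotone convergence removes it
  again while proving integrability of the limit. Inner products of translates are never formed: the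
  isometry is applied to a whole finite sum of translates, whose transform is a trigonometric
  polynomial times the transform of \<phi>, and the Gram form appears on expanding the squared
  modulus of that polynomial. The norm identity is proved for every \<open>g\<close> with
  \<open>is_fourier_L2 f g\<close>, so the representative selected by \<open>fourier_L2\<close> does
  not matter. The L2 facts have the measure as a parameter because Fubini's theorem is applied over
  \<open>lborel\<close>, whereas the theorem speaks of \<open>lebesgue\<close>.\<close>

definition sq_integrable :: "'a measure \<Rightarrow> ('a \<Rightarrow> complex) \<Rightarrow> bool" where
  "sq_integrable M f \<longleftrightarrow> f \<in> borel_measurable M \<and> integrable M (\<lambda>x. (cmod (f x))\<^sup>2)"

definition l2norm :: "'a measure \<Rightarrow> ('a \<Rightarrow> complex) \<Rightarrow> real" where
  "l2norm M f = sqrt (LINT x|M. (cmod (f x))\<^sup>2)"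

lemma sq_integrable_measurable [dest]: "sq_integrable M f \<Longrightarrow> f \<in> borel_measurable M"
  by (simp add: sq_integrable_def)

lemma l2norm_nonneg [simp]: "0 \<le> l2norm M f"
  by (simp add: l2norm_def)

lemma l2norm_power2: "(l2norm M f)\<^sup>2 = (LINT x|M. (cmod (f x))\<^sup>2)"
  by (simp add: l2norm_def)

lemma l2norm_minus_commute: "l2norm M (\<lambda>x. f x - g x) = l2norm M (\<lambda>x. g x - f x)"
  by (simp add: l2norm_def norm_minus_commute)

lemma sq_integrable_mono:
  assumes "sq_integrable M g" "f \<in> borel_measurable M" "AE x in M. cmod (f x) \<le> C * cmod (g x)"
  shows "sq_integrable M f"
  unfolding sq_integrable_def
proof
  show "integrable M (\<lambda>x. (cmod (f x))\<^sup>2)"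
  proof (rule Bochner_Integration.integrable_bound)
    show "integrable M (\<lambda>x. C\<^sup>2 * (cmod (g x))\<^sup>2)"
      using assms(1) by (simp add: sq_integrable_def)
    show "AE x in M. norm ((cmod (f x))\<^sup>2) \<le> norm (C\<^sup>2 * (cmod (g x))\<^sup>2)"
      using assms(3)
    proof eventually_elim
      case (elim x)
      then have "(cmod (f x))\<^sup>2 \<le> (C * cmod (g x))\<^sup>2"
        by (intro power_mono) auto
      then show ?case by (simp add: power_mult_distrib)
    qed
  qed (use assms in measurable)
qed fact

lemma l2norm_mono:
  assumes "sq_integrable M g" "f \<in> borel_measurable M" "0 \<le> C"
    and "AE x in M. cmod (f x) \<le> C * cmod (g x)"
  shows "l2norm M f \<le> C * l2norm M g"
proof -
  have sf: "sq_integrable M f" by (rule sq_integrable_mono[OF assms(1,2,4)])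
  have "(LINT x|M. (cmod (f x))\<^sup>2) \<le> (LINT x|M. C\<^sup>2 * (cmod (g x))\<^sup>2)"
  proof (rule integral_mono_AE)
    show "AE x in M. (cmod (f x))\<^sup>2 \<le> C\<^sup>2 * (cmod (g x))\<^sup>2"
      using assms(4)
    proof eventually_elim
      case (elim x)
      then have "(cmod (f x))\<^sup>2 \<le> (C * cmod (g x))\<^sup>2"
        by (intro power_mono) auto
      then show ?case by (simp add: power_mult_distrib)
    qed
  qed (use sf assms(1) in \<open>auto simp: sq_integrable_def\<close>)
  then have "(l2norm M f)\<^sup>2 \<le> (C * l2norm M g)\<^sup>2"
    by (simp add: l2norm_power2 power_mult_distrib)
  then show ?thesis
    by (rule power2_le_imp_le) (simp add: assms(3))
qed

lemma sq_integrable_add: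
  assumes "sq_integrable M f" "sq_integrable M g"
  shows "sq_integrable M (\<lambda>x. f x + g x)"
  unfolding sq_integrable_def
proof
  have fg [measurable]: "f \<in> borel_measurable M" "g \<in> borel_measurable M"
    using assms by auto
  show "(\<lambda>x. f x + g x) \<in> borel_measurable M" by measurable
  show "integrable M (\<lambda>x. (cmod (f x + g x))\<^sup>2)"
  proof (rule Bochner_Integration.integrable_bound)
    show "integrable M (\<lambda>x. 2 * (cmod (f x))\<^sup>2 + 2 * (cmod (g x))\<^sup>2)"
      using assms by (simp add: sq_integrable_def)
    show "AE x in M. norm ((cmod (f x + g x))\<^sup>2) \<le> norm (2 * (cmod (f x))\<^sup>2 + 2 * (cmod (g x))\<^sup>2)"
    proof (rule AE_I2)
      fix x
      have "(cmod (f x + g x))\<^sup>2 \<le> (cmod (f x) + cmod (g x))\<^sup>2"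
        by (intro power_mono norm_triangle_ineq) auto
      also have "\<dots> \<le> 2 * (cmod (f x))\<^sup>2 + 2 * (cmod (g x))\<^sup>2"
        using zero_le_power2[of "cmod (f x) - cmod (g x)"]
        by (simp add: power2_eq_square algebra_simps)
      finally show "norm ((cmod (f x + g x))\<^sup>2) \<le> norm (2 * (cmod (f x))\<^sup>2 + 2 * (cmod (g x))\<^sup>2)"
        by simp
    qed
  qed measurable
qed

lemma sq_integrable_cmult:
  assumes "sq_integrable M f" shows "sq_integrable M (\<lambda>x. c * f x)"
  using assms
  by (intro sq_integrable_mono[OF assms, where C = "cmod c"]) (auto simp: norm_mult)

lemma sq_integrable_diff:
  assumes "sq_integrable M f" "sq_integrable M g"
  shows "sq_integrable M (\<lambda>x. f x - g x)"
  using sq_integrable_add[OF assms(1) sq_integrable_cmult[OF assms(2), of "-1"]] by simp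

lemma sq_integrable_zero [simp]: "sq_integrable M (\<lambda>x. 0)"
  by (simp add: sq_integrable_def)

lemma sq_integrable_sum:
  "(\<And>k. k \<in> K \<Longrightarrow> sq_integrable M (f k)) \<Longrightarrow> sq_integrable M (\<lambda>x. \<Sum>k\<in>K. f k x)"
  by (induction K rule: infinite_finite_induct) (auto intro!: sq_integrable_add)

lemma sq_integrable_cnj: "sq_integrable M f \<Longrightarrow> sq_integrable M (\<lambda>x. cnj (f x))"
  by (simp add: sq_integrable_def borel_measurable_complex_iff)

lemma sq_integrable_mult_integrable:
  assumes "sq_integrable M f" "sq_integrable M g"
  shows "integrable M (\<lambda>x. f x * g x)"
proof (rule Bochner_Integration.integrable_bound)
  have fg [measurable]: "f \<in> borel_measurable M" "g \<in> borel_measurable M"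
    using assms by auto
  show "integrable M (\<lambda>x. (cmod (f x))\<^sup>2 + (cmod (g x))\<^sup>2)"
    using assms by (simp add: sq_integrable_def)
  show "(\<lambda>x. f x * g x) \<in> borel_measurable M" by measurable
  show "AE x in M. norm (f x * g x) \<le> norm ((cmod (f x))\<^sup>2 + (cmod (g x))\<^sup>2)"
  proof (rule AE_I2)
    fix x
    show "norm (f x * g x) \<le> norm ((cmod (f x))\<^sup>2 + (cmod (g x))\<^sup>2)"
      using zero_le_power2[of "cmod (f x) - cmod (g x)"]
        mult_nonneg_nonneg[OF norm_ge_zero[of "f x"] norm_ge_zero[of "g x"]]
      unfolding norm_mult power2_diff real_norm_def by linarith
  qed
qed

section \<open>Cauchy-Schwarz and triangle inequalities\<close>

lemma l2norm_eq_0_imp_AE: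
  assumes "sq_integrable M f" "l2norm M f = 0" shows "AE x in M. f x = 0"
proof -
  have "(LINT x|M. (cmod (f x))\<^sup>2) = 0"
    using assms(2) by (simp add: l2norm_def)
  then have "AE x in M. (cmod (f x))\<^sup>2 = 0"
    using assms(1) by (subst (asm) integral_nonneg_eq_0_iff_AE) (auto simp: sq_integrable_def)
  then show ?thesis by simp
qed

lemma l2_Cauchy_Schwarz_norm:
  assumes "sq_integrable M f" "sq_integrable M g"
  shows "(LINT x|M. cmod (f x) * cmod (g x)) \<le> l2norm M f * l2norm M g"
proof (cases "l2norm M f = 0 \<or> l2norm M g = 0")
  case True
  then have "AE x in M. cmod (f x) * cmod (g x) = 0"
  proof
    assume "l2norm M f = 0"
    from l2norm_eq_0_imp_AE[OF assms(1) this] show ?thesis by eventually_elim simp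
  next
    assume "l2norm M g = 0"
    from l2norm_eq_0_imp_AE[OF assms(2) this] show ?thesis by eventually_elim simp
  qed
  then have "(LINT x|M. cmod (f x) * cmod (g x)) = 0"
    by (simp add: integral_eq_zero_AE)
  then show ?thesis by simp
next
  case False
  define a b where "a = l2norm M f" and "b = l2norm M g"
  have pos: "0 < a" "0 < b"
    using False l2norm_nonneg[of M f] l2norm_nonneg[of M g] by (auto simp: a_def b_def less_le)
  have int: "integrable M (\<lambda>x. cmod (f x) * cmod (g x))"
    using integrable_norm[OF sq_integrable_mult_integrable[OF assms]] by (simp add: norm_mult)
  \<comment> \<open>The weights make each of the two terms integrate to \<open>a * b / 2\<close>.
    They require both norms to be nonzero, hence the case distinction.\<close>
  have "(LINT x|M. cmod (f x) * cmod (g x))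
      \<le> (LINT x|M. b / (2 * a) * (cmod (f x))\<^sup>2 + a / (2 * b) * (cmod (g x))\<^sup>2)"
  proof (rule integral_mono[OF int])
    fix x
    have "0 \<le> (b * cmod (f x) - a * cmod (g x))\<^sup>2 / (2 * a * b)"
      using pos by simp
    also have "\<dots> = b / (2 * a) * (cmod (f x))\<^sup>2 + a / (2 * b) * (cmod (g x))\<^sup>2 - cmod (f x) * cmod (g x)"
      using pos by (simp add: field_simps power2_eq_square)
    finally show "cmod (f x) * cmod (g x) \<le> b / (2 * a) * (cmod (f x))\<^sup>2 + a / (2 * b) * (cmod (g x))\<^sup>2"
      by simp
  qed (use assms in \<open>auto simp: sq_integrable_def\<close>)
  also have "\<dots> = b / (2 * a) * a\<^sup>2 + a / (2 * b) * b\<^sup>2"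
    using assms by (simp add: a_def b_def l2norm_power2 sq_integrable_def)
  also have "\<dots> = a * b"
    using pos by (simp add: field_simps power2_eq_square)
  finally show ?thesis by (simp add: a_def b_def)
qed

lemma l2_Cauchy_Schwarz:
  assumes "sq_integrable M f" "sq_integrable M g"
  shows "cmod (LINT x|M. f x * g x) \<le> l2norm M f * l2norm M g"
proof -
  have "cmod (LINT x|M. f x * g x) \<le> (LINT x|M. cmod (f x * g x))"
    by (rule integral_norm_bound)
  then show ?thesis
    using l2_Cauchy_Schwarz_norm[OF assms] by (simp add: norm_mult)
qed

lemma l2norm_triangle:
  assumes "sq_integrable M f" "sq_integrable M g"
  shows "l2norm M (\<lambda>x. f x + g x) \<le> l2norm M f + l2norm M g"
proof (rule power2_le_imp_le)
  have int: "integrable M (\<lambda>x. cmod (f x) * cmod (g x))"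
    using integrable_norm[OF sq_integrable_mult_integrable[OF assms]] by (simp add: norm_mult)
  have "(l2norm M (\<lambda>x. f x + g x))\<^sup>2 \<le>
      (LINT x|M. (cmod (f x))\<^sup>2 + 2 * (cmod (f x) * cmod (g x)) + (cmod (g x))\<^sup>2)"
    unfolding l2norm_power2
  proof (rule integral_mono)
    show "integrable M (\<lambda>x. (cmod (f x + g x))\<^sup>2)"
      using sq_integrable_add[OF assms] by (simp add: sq_integrable_def)
    show "integrable M (\<lambda>x. (cmod (f x))\<^sup>2 + 2 * (cmod (f x) * cmod (g x)) + (cmod (g x))\<^sup>2)"
      using int assms by (simp add: sq_integrable_def)
    fix x
    have "(cmod (f x + g x))\<^sup>2 \<le> (cmod (f x) + cmod (g x))\<^sup>2"
      by (intro power_mono norm_triangle_ineq) auto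
    then show "(cmod (f x + g x))\<^sup>2 \<le> (cmod (f x))\<^sup>2 + 2 * (cmod (f x) * cmod (g x)) + (cmod (g x))\<^sup>2"
      by (simp add: power2_sum)
  qed
  also have "\<dots> = (l2norm M f)\<^sup>2 + 2 * (LINT x|M. cmod (f x) * cmod (g x)) + (l2norm M g)\<^sup>2"
    using int assms by (simp add: l2norm_power2 sq_integrable_def)
  also have "\<dots> \<le> (l2norm M f + l2norm M g)\<^sup>2"
    using l2_Cauchy_Schwarz_norm[OF assms] by (simp add: power2_sum)
  finally show "(l2norm M (\<lambda>x. f x + g x))\<^sup>2 \<le> (l2norm M f + l2norm M g)\<^sup>2" .
qed simp

lemma l2norm_triangle_diff:
  assumes "sq_integrable M f" "sq_integrable M g" "sq_integrable M h"
  shows "l2norm M (\<lambda>x. f x - h x) \<le> l2norm M (\<lambda>x. f x - g x) + l2norm M (\<lambda>x. g x - h x)"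
  using l2norm_triangle[OF sq_integrable_diff[OF assms(1,2)] sq_integrable_diff[OF assms(2,3)]] by simp

lemma l2norm_cmult: "l2norm M (\<lambda>x. c * f x) = cmod c * l2norm M f"
  by (simp add: l2norm_def norm_mult power_mult_distrib real_sqrt_mult)

lemma l2norm_sum_le:
  "(\<And>k. k \<in> K \<Longrightarrow> sq_integrable M (f k)) \<Longrightarrow> l2norm M (\<lambda>x. \<Sum>k\<in>K. f k x) \<le> (\<Sum>k\<in>K. l2norm M (f k))"
proof (induction K rule: infinite_finite_induct)
  case (insert k K)
  have "l2norm M (\<lambda>x. f k x + (\<Sum>k\<in>K. f k x)) \<le> l2norm M (f k) + l2norm M (\<lambda>x. \<Sum>k\<in>K. f k x)"
    using insert.prems by (intro l2norm_triangle sq_integrable_sum) auto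
  then show ?case using insert by simp
qed (simp_all add: l2norm_def)

section \<open>Convergence in L2 and completeness\<close>

lemma l2norm_tendsto:
  assumes "\<And>n. sq_integrable M (u n)" "sq_integrable M f"
    and lim: "(\<lambda>n::nat. l2norm M (\<lambda>x. u n x - f x)) \<longlonglongrightarrow> 0"
  shows "(\<lambda>n. l2norm M (u n)) \<longlonglongrightarrow> l2norm M f"
proof -
  have "\<bar>l2norm M (u n) - l2norm M f\<bar> \<le> l2norm M (\<lambda>x. u n x - f x)" for n
    using l2norm_triangle[of M "\<lambda>x. u n x - f x" f] l2norm_triangle[of M "\<lambda>x. f x - u n x" "u n"]
      sq_integrable_diff[of M] assms(1)[of n] assms(2)
    by (auto simp: l2norm_minus_commute[of M f])
  then have "(\<lambda>n. l2norm M (u n) - l2norm M f) \<longlonglongrightarrow> 0"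
    by (intro Lim_null_comparison[OF always_eventually lim]) simp
  then show ?thesis by (simp add: LIM_zero_iff)
qed

lemma l2norm_dominated_convergence:
  fixes u :: "nat \<Rightarrow> 'a \<Rightarrow> complex"
  assumes [measurable]: "\<And>n. u n \<in> borel_measurable M" "f \<in> borel_measurable M"
    and w: "integrable M w" and bound: "\<And>n x. (cmod (u n x - f x))\<^sup>2 \<le> w x"
    and lim: "AE x in M. (\<lambda>n. u n x) \<longlonglongrightarrow> f x"
  shows "(\<lambda>n. l2norm M (\<lambda>x. u n x - f x)) \<longlonglongrightarrow> 0"
proof -
  have "(\<lambda>n. LINT x|M. (cmod (u n x - f x))\<^sup>2) \<longlonglongrightarrow> (LINT x|M. 0)"
  proof (rule integral_dominated_convergence)
    show "AE x in M. (\<lambda>n. (cmod (u n x - f x))\<^sup>2) \<longlonglongrightarrow> 0"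
      using lim
    proof eventually_elim
      case (elim x)
      have "(\<lambda>n. (cmod (u n x - f x))\<^sup>2) \<longlonglongrightarrow> (cmod (f x - f x))\<^sup>2"
        by (intro tendsto_intros elim)
      then show ?case by simp
    qed
    show "AE x in M. norm ((cmod (u n x - f x))\<^sup>2) \<le> w x" for n
      using bound by simp
  qed (use w in measurable)
  then have "(\<lambda>n. sqrt (LINT x|M. (cmod (u n x - f x))\<^sup>2)) \<longlonglongrightarrow> sqrt (LINT x|M. 0)"
    by (intro tendsto_intros)
  then show ?thesis by (simp add: l2norm_def)
qed

lemma l2norm_cong_AE:
  assumes "AE x in M. f x = g x" "f \<in> borel_measurable M" "g \<in> borel_measurable M"
  shows "l2norm M f = l2norm M g"
  unfolding l2norm_def using assms
  by (intro arg_cong[where f = sqrt] integral_cong_AE) (auto intro: AE_mp)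

lemma sq_integrable_cong_AE:
  assumes "AE x in M. f x = g x" "f \<in> borel_measurable M" "g \<in> borel_measurable M"
  shows "sq_integrable M f \<longleftrightarrow> sq_integrable M g"
proof -
  have "integrable M (\<lambda>x. (cmod (f x))\<^sup>2) \<longleftrightarrow> integrable M (\<lambda>x. (cmod (g x))\<^sup>2)"
    using assms by (intro integrable_cong_AE) auto
  then show ?thesis using assms by (simp add: sq_integrable_def)
qed

text \<open>Fatou's lemma for the squared moduli. The norm bound is an eventual one because the
  application is to \<open>u m - u n\<close> with \<open>n\<close> fixed, which is controlled for
  \<open>m\<close> at least \<open>n\<close>.\<close>

lemma l2_Fatou:
  fixes v :: "nat \<Rightarrow> 'a \<Rightarrow> complex"
  assumes v: "\<And>m. sq_integrable M (v m)" and f: "f \<in> borel_measurable M" and "0 \<le> C"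
    and lim: "AE x in M. (\<lambda>m. v m x) \<longlonglongrightarrow> f x"
    and bound: "\<forall>\<^sub>F m in sequentially. l2norm M (v m) \<le> C"
  shows "sq_integrable M f" and "l2norm M f \<le> C"
proof -
  have [measurable]: "\<And>m. v m \<in> borel_measurable M" "f \<in> borel_measurable M"
    using v f by auto
  have "(\<integral>\<^sup>+x. ennreal ((cmod (f x))\<^sup>2) \<partial>M) = (\<integral>\<^sup>+x. liminf (\<lambda>m. ennreal ((cmod (v m x))\<^sup>2)) \<partial>M)"
  proof (rule nn_integral_cong_AE)
    show "AE x in M. ennreal ((cmod (f x))\<^sup>2) = liminf (\<lambda>m. ennreal ((cmod (v m x))\<^sup>2))"
      using lim
    proof eventually_elim
      case (elim x)
      have "(\<lambda>m. ennreal ((cmod (v m x))\<^sup>2)) \<longlonglongrightarrow> ennreal ((cmod (f x))\<^sup>2)"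
        by (intro tendsto_intros elim)
      then show ?case using lim_imp_Liminf[OF trivial_limit_sequentially] by metis
    qed
  qed
  also have "\<dots> \<le> liminf (\<lambda>m. \<integral>\<^sup>+x. ennreal ((cmod (v m x))\<^sup>2) \<partial>M)"
    by (rule nn_integral_liminf) measurable
  also have "\<dots> \<le> ennreal (C\<^sup>2)"
  proof (rule Liminf_le)
    show "\<forall>\<^sub>F m in sequentially. (\<integral>\<^sup>+x. ennreal ((cmod (v m x))\<^sup>2) \<partial>M) \<le> ennreal (C\<^sup>2)"
      using bound
    proof eventually_elim
      case (elim m)
      then have "(l2norm M (v m))\<^sup>2 \<le> C\<^sup>2" by (intro power_mono) auto
      then show ?case
        using v[of m] by (simp add: l2norm_power2 nn_integral_eq_integral sq_integrable_def ennreal_leI)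
    qed
  qed simp
  finally have le: "(\<integral>\<^sup>+x. ennreal ((cmod (f x))\<^sup>2) \<partial>M) \<le> ennreal (C\<^sup>2)" .
  have int: "integrable M (\<lambda>x. (cmod (f x))\<^sup>2)"
    unfolding integrable_iff_bounded
  proof
    show "(\<lambda>x. (cmod (f x))\<^sup>2) \<in> borel_measurable M" by measurable
    show "(\<integral>\<^sup>+x. ennreal (norm ((cmod (f x))\<^sup>2)) \<partial>M) < \<infinity>"
      using order.strict_trans1[OF le ennreal_less_top] by simp
  qed
  then show "sq_integrable M f" using f by (simp add: sq_integrable_def)
  have "ennreal ((l2norm M f)\<^sup>2) \<le> ennreal (C\<^sup>2)"
    using le int by (simp add: l2norm_power2 nn_integral_eq_integral)
  then have "(l2norm M f)\<^sup>2 \<le> C\<^sup>2" by (simp add: ennreal_le_iff)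
  then show "l2norm M f \<le> C" by (rule power2_le_imp_le) fact
qed

text \<open>
  By the arithmetic-geometric mean inequality
  \<open>\<bar>u\<^sub>k\<^sub>+\<^sub>1 - u\<^sub>k\<bar> \<le> 2\<^sup>-\<^sup>k + 2\<^sup>k \<bar>u\<^sub>k\<^sub>+\<^sub>1 - u\<^sub>k\<bar>\<^sup>2\<close>,
  and the right-hand side is summable almost everywhere because its integrals are summable
  in the second term.
\<close>

lemma l2_fast_Cauchy_AE_convergent:
  fixes u :: "nat \<Rightarrow> 'a \<Rightarrow> complex"
  assumes u: "\<And>n. sq_integrable M (u n)"
    and fast: "\<And>n. l2norm M (\<lambda>x. u (Suc n) x - u n x) \<le> (1 / 2) ^ n"
  shows "AE x in M. convergent (\<lambda>n. u n x)"
proof -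
  define d where "d = (\<lambda>n x. u (Suc n) x - u n x)"
  have sd: "sq_integrable M (d n)" for n
    unfolding d_def by (intro sq_integrable_diff u)
  have [measurable]: "\<And>n. d n \<in> borel_measurable M"
    using sd by auto
  have fin: "(\<integral>\<^sup>+x. (\<Sum>n. ennreal (2 ^ n * (cmod (d n x))\<^sup>2)) \<partial>M) \<le> (\<Sum>n. ennreal ((1/2)^n))"
  proof -
    have "(\<integral>\<^sup>+x. ennreal (2 ^ n * (cmod (d n x))\<^sup>2) \<partial>M) \<le> ennreal ((1/2)^n)" for n
    proof -
      have "(\<integral>\<^sup>+x. ennreal (2 ^ n * (cmod (d n x))\<^sup>2) \<partial>M) = ennreal (LINT x|M. 2 ^ n * (cmod (d n x))\<^sup>2)"
        using sd[of n] by (intro nn_integral_eq_integral) (auto simp: sq_integrable_def)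
      also have "(LINT x|M. 2 ^ n * (cmod (d n x))\<^sup>2) = 2 ^ n * (l2norm M (d n))\<^sup>2"
        by (simp add: l2norm_power2)
      also have "\<dots> \<le> 2 ^ n * ((1/2) ^ n)\<^sup>2"
        using fast[of n] by (intro mult_left_mono power_mono) (auto simp: d_def)
      also have "\<dots> = (1/2) ^ n"
        by (simp add: power2_eq_square power_one_over)
      finally show ?thesis by (simp add: ennreal_leI)
    qed
    then show ?thesis
      by (subst nn_integral_suminf) (auto intro!: suminf_le)
  qed
  have "(\<Sum>n. ennreal ((1/2::real)^n)) = ennreal (\<Sum>n. (1/2)^n)"
    by (intro suminf_ennreal2 summable_geometric) auto
  then have "(\<integral>\<^sup>+x. (\<Sum>n. ennreal (2 ^ n * (cmod (d n x))\<^sup>2)) \<partial>M) \<noteq> \<infinity>"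
    using fin by (auto simp: top_unique)
  then have "AE x in M. (\<Sum>n. ennreal (2 ^ n * (cmod (d n x))\<^sup>2)) \<noteq> \<infinity>"
    by (intro nn_integral_PInf_AE) measurable
  then show ?thesis
  proof eventually_elim
    case (elim x)
    have "summable (\<lambda>n. 2 ^ n * (cmod (d n x))\<^sup>2)"
    proof (rule summable_suminf_not_top)
      show "(\<Sum>n. ennreal (2 ^ n * (cmod (d n x))\<^sup>2)) \<noteq> top"
        using elim unfolding infinity_ennreal_def .
    qed simp
    then have "summable (\<lambda>n. (1/2)^n + 2 ^ n * (cmod (d n x))\<^sup>2)"
      by (intro summable_add summable_geometric) auto
    moreover have "cmod (d n x) \<le> (1/2)^n + 2 ^ n * (cmod (d n x))\<^sup>2" for n
    proof -
      define a b where "a = cmod (d n x)" and "b = (2::real) ^ n"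
      have "b > 0" "a \<ge> 0" by (simp_all add: a_def b_def)
      then have "0 \<le> (1 - b * a)\<^sup>2 / b" by simp
      also have "\<dots> = 1 / b + b * a\<^sup>2 - 2 * a"
        using \<open>b > 0\<close> by (simp add: field_simps power2_eq_square)
      finally have "a \<le> 1 / b + b * a\<^sup>2"
        using \<open>a \<ge> 0\<close> by linarith
      then show ?thesis
        by (simp add: a_def b_def power_one_over)
    qed
    ultimately have "summable (\<lambda>n. d n x)"
      by (intro summable_comparison_test[of "\<lambda>n. d n x"]) auto
    then have "convergent (\<lambda>n. \<Sum>k<n. d k x)"
      by (simp add: summable_iff_convergent)
    then have "convergent (\<lambda>n. (\<Sum>k<n. d k x) + u 0 x)"
      by (intro convergent_add convergent_const)
    moreover have "(\<Sum>k<n. d k x) + u 0 x = u n x" for n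
      unfolding d_def using sum_lessThan_telescope[of "\<lambda>k. u k x" n] by simp
    ultimately show ?case by simp
  qed
qed

text \<open>Completeness of L2 in the form that later yields limits of transforms. The candidate is
  the pointwise limit; Fatou's lemma in the larger index turns Cauchy estimates into distances from
  it.\<close>

lemma l2_fast_Cauchy_limit:
  fixes u :: "nat \<Rightarrow> 'a \<Rightarrow> complex"
  assumes u: "\<And>n. sq_integrable M (u n)"
    and fast: "\<And>n. l2norm M (\<lambda>x. u (Suc n) x - u n x) \<le> (1 / 2) ^ n"
  obtains f where "sq_integrable M f" "(\<lambda>n. l2norm M (\<lambda>x. u n x - f x)) \<longlonglongrightarrow> 0"
proof -
  define f where "f x = lim (\<lambda>n. u n x)" for x
  have [measurable]: "\<And>n. u n \<in> borel_measurable M"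
    using u by auto
  have fm [measurable]: "f \<in> borel_measurable M"
    unfolding f_def by (rule borel_measurable_lim_metric) measurable
  have lim: "AE x in M. (\<lambda>n. u n x) \<longlonglongrightarrow> f x"
    using l2_fast_Cauchy_AE_convergent[OF u fast]
    by eventually_elim (simp add: f_def convergent_LIMSEQ_iff)
  \<comment> \<open>Keeping the exact remainder of the geometric series closes the induction: from
    \<open>k\<close> to \<open>Suc k\<close> the subtracted term is halved, which frees exactly
    \<open>(1/2)^(n + k)\<close>.\<close>
  have dist: "l2norm M (\<lambda>x. u (n + k) x - u n x) \<le> 2 * (1/2)^n - 2 * (1/2)^(n + k)" for n k
  proof (induction k)
    case (Suc k)
    have "l2norm M (\<lambda>x. u (n + Suc k) x - u n x)
        \<le> l2norm M (\<lambda>x. u (Suc (n + k)) x - u (n + k) x) + l2norm M (\<lambda>x. u (n + k) x - u n x)"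
      using l2norm_triangle_diff[where f = "u (Suc (n + k))" and g = "u (n + k)" and h = "u n", OF u u u]
      by simp
    also have "\<dots> \<le> (1/2)^(n + k) + (2 * (1/2)^n - 2 * (1/2)^(n + k))"
      by (intro add_mono fast Suc)
    finally show ?case by simp
  qed (simp add: l2norm_def)
  have close: "sq_integrable M (\<lambda>x. f x - u n x) \<and> l2norm M (\<lambda>x. f x - u n x) \<le> 2 * (1/2)^n" for n
  proof -
    have "\<forall>\<^sub>F m in sequentially. l2norm M (\<lambda>x. u m x - u n x) \<le> 2 * (1/2)^n"
      using eventually_ge_at_top[of n]
    proof eventually_elim
      case (elim m)
      then show ?case
        using dist[of n "m - n"] by (simp add: order_trans)
    qed
    moreover have "AE x in M. (\<lambda>m. u m x - u n x) \<longlonglongrightarrow> f x - u n x"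
      using lim by eventually_elim (intro tendsto_intros)
    ultimately show ?thesis
      using l2_Fatou[of M "\<lambda>m x. u m x - u n x" "\<lambda>x. f x - u n x" "2 * (1/2)^n"] u
      by (simp add: sq_integrable_diff)
  qed
  show thesis
  proof
    show "sq_integrable M f"
      using sq_integrable_add[of M "\<lambda>x. f x - u 0 x" "u 0"] close[of 0] u[of 0] by simp
    show "(\<lambda>n. l2norm M (\<lambda>x. u n x - f x)) \<longlonglongrightarrow> 0"
    proof (rule Lim_null_comparison[rotated, where g = "\<lambda>n. 2 * (1/2::real)^n"])
      have "norm (l2norm M (\<lambda>x. u n x - f x)) \<le> 2 * (1/2)^n" for n
        using close[of n] l2norm_minus_commute[of M "u n" f] by simp
      then show "\<forall>\<^sub>F n in sequentially. norm (l2norm M (\<lambda>x. u n x - f x)) \<le> 2 * (1/2)^n"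
        by simp
      have "(\<lambda>n. 2 * (1/2::real)^n) \<longlonglongrightarrow> 2 * 0"
        by (intro tendsto_intros LIMSEQ_power_zero) auto
      then show "(\<lambda>n. 2 * (1/2::real)^n) \<longlonglongrightarrow> 0"
        by simp
    qed
  qed
qed

section \<open>Affine substitution and translation\<close>

text \<open>Used for the shift \<open>c = 1\<close>, the reflection \<open>c = - 1\<close> and the
  dilation \<open>c = s\<close> in the Plancherel argument.\<close>

lemma
  fixes f :: "'a::euclidean_space \<Rightarrow> 'b::{banach, second_countable_topology}"
  assumes [measurable]: "f \<in> borel_measurable borel" and "c \<noteq> 0"
  shows lborel_integral_affine:
      "(LINT x|lborel. f x) = \<bar>c\<bar> ^ DIM('a) *\<^sub>R (LINT x|lborel. f (t + c *\<^sub>R x))"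
    and lborel_integrable_affine_iff:
      "integrable lborel (\<lambda>x. f (t + c *\<^sub>R x)) \<longleftrightarrow> integrable lborel f"
proof -
  have [measurable]: "(\<lambda>x. t + c *\<^sub>R x) \<in> borel_measurable borel"
    by measurable
  have eq: "lborel = density (distr lborel borel (\<lambda>x. t + c *\<^sub>R x)) (\<lambda>_. ennreal (\<bar>c\<bar> ^ DIM('a)))"
    using lborel_affine[OF \<open>c \<noteq> 0\<close>, of t] by (simp add: ennreal_power)
  show "(LINT x|lborel. f x) = \<bar>c\<bar> ^ DIM('a) *\<^sub>R (LINT x|lborel. f (t + c *\<^sub>R x))"
    by (subst eq) (simp add: integral_density integral_distr)
  show "integrable lborel (\<lambda>x. f (t + c *\<^sub>R x)) \<longleftrightarrow> integrable lborel f"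
    \<comment> \<open>The density contributes a constant factor; scaling by it and by its inverse
      gives the two directions.\<close>
    using \<open>c \<noteq> 0\<close> integrable_scaleR_right[of "\<bar>c\<bar> ^ DIM('a)" lborel "\<lambda>x. f (t + c *\<^sub>R x)"]
      integrable_scaleR_right[of "inverse (\<bar>c\<bar> ^ DIM('a))" lborel
        "\<lambda>x. \<bar>c\<bar> ^ DIM('a) *\<^sub>R f (t + c *\<^sub>R x)"]
    by (subst (2) eq) (auto simp add: integrable_density integrable_distr_eq)
qed

text \<open>A shift is an affine map with all coefficients 1, so the density in the affine change of
  variables is 1. Borel measurability of the shift would not suffice: preimages of Lebesgue
  measurable sets must again be Lebesgue measurable.\<close>

lemma
  fixes a :: "'a::euclidean_space"
  shows measurable_lebesgue_shift [measurable]: "(\<lambda>x. x - a) \<in> lebesgue \<rightarrow>\<^sub>M lebesgue"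
    and distr_lebesgue_shift: "distr lebesgue lebesgue (\<lambda>x. x - a) = lebesgue"
proof -
  have T: "(\<lambda>x. - a + (\<Sum>j\<in>Basis. (1 * (x \<bullet> j)) *\<^sub>R j)) = (\<lambda>x. x - a)"
    by (simp add: euclidean_representation)
  show "(\<lambda>x. x - a) \<in> lebesgue \<rightarrow>\<^sub>M lebesgue"
    using lebesgue_affine_measurable[of "\<lambda>_. 1" "- a"] T by simp
  show "distr lebesgue lebesgue (\<lambda>x. x - a) = lebesgue"
    using lebesgue_affine_euclidean[of "\<lambda>_. 1" "- a"] T by (simp add: density_1)
qed

lemma
  fixes f :: "'a::euclidean_space \<Rightarrow> 'b::{banach, second_countable_topology}"
  assumes "f \<in> borel_measurable lebesgue"
  shows lebesgue_integral_shift: "(LINT x|lebesgue. f (x - a)) = (LINT x|lebesgue. f x)"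
    and lebesgue_integrable_shift_iff: "integrable lebesgue (\<lambda>x. f (x - a)) \<longleftrightarrow> integrable lebesgue f"
  using integral_distr[OF measurable_lebesgue_shift assms, of a]
    integrable_distr_eq[OF measurable_lebesgue_shift assms, of a]
  by (simp_all add: distr_lebesgue_shift)

lemma translate_measurable:
  assumes "f \<in> borel_measurable lebesgue"
  shows "translate a f \<in> borel_measurable lebesgue"
  unfolding translate_def using measurable_compose[OF measurable_lebesgue_shift assms] .

lemma sq_integrable_translate:
  assumes "sq_integrable lebesgue f" shows "sq_integrable lebesgue (translate a f)"
proof -
  have f: "f \<in> borel_measurable lebesgue" using assms by auto
  then have "(\<lambda>x. (cmod (f x))\<^sup>2) \<in> borel_measurable lebesgue" by measurable
  then show ?thesis
    using assms lebesgue_integrable_shift_iff[of "\<lambda>x. (cmod (f x))\<^sup>2" a] translate_measurable[OF f]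
    by (simp add: sq_integrable_def translate_def)
qed

lemma l2norm_translate:
  assumes f: "f \<in> borel_measurable lebesgue"
  shows "l2norm lebesgue (translate a f) = l2norm lebesgue f"
proof -
  have "(\<lambda>x. (cmod (f x))\<^sup>2) \<in> borel_measurable lebesgue" using f by measurable
  then show ?thesis
    using lebesgue_integral_shift[of "\<lambda>x. (cmod (f x))\<^sup>2" a]
    by (simp add: l2norm_def translate_def)
qed

text \<open>Transfers Plancherel's theorem from Borel functions, where Fubini's theorem is applied,
  to Lebesgue measurable ones.\<close>

lemma borel_representative:
  fixes f :: "'a::euclidean_space \<Rightarrow> complex"
  assumes f: "f \<in> borel_measurable lebesgue"
  obtains g where "g \<in> borel_measurable borel" "AE x in lebesgue. f x = g x"
proof -
  have "(\<lambda>x. Re (f x)) \<in> borel_measurable lebesgue" "(\<lambda>x. Im (f x)) \<in> borel_measurable lebesgue"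
    using f by measurable
  then obtain g h where gh [measurable]: "g \<in> borel_measurable borel" "h \<in> borel_measurable borel"
    and AE: "AE x in lborel. Re (f x) = g x" "AE x in lborel. Im (f x) = h x"
    by (auto dest!: completion_ex_borel_measurable_real)
  show thesis
  proof
    show "(\<lambda>x. Complex (g x) (h x)) \<in> borel_measurable borel"
      by (simp add: borel_measurable_complex_iff)
    have "AE x in lborel. f x = Complex (g x) (h x)"
      using AE by eventually_elim (simp add: complex_eq_iff)
    then show "AE x in lebesgue. f x = Complex (g x) (h x)"
      by (rule AE_completion)
  qed
qed

section \<open>Continuity of translation\<close>

lemma integrable_indicator_cball:
  "integrable lebesgue (\<lambda>x::'a::euclidean_space. C * indicator (cball a r) x :: real)"
proof (intro integrable_mult_right integrable_real_indicator)
  show "emeasure lebesgue (cball a r) < \<infinity>"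
    using emeasure_bounded_finite[OF bounded_cball, of a r] by simp
qed simp

text \<open>Truncation in argument and value keeps the error below the modulus of \<open>f\<close>,
  so dominated convergence applies. Bounded functions of bounded support are also integrable, so
  these truncations serve again as the approximants in L1 and L2 from which the transform on L2 is
  built.\<close>

lemma l2_approx_bounded_support:
  fixes f :: "'a::euclidean_space \<Rightarrow> complex"
  assumes f: "sq_integrable lebesgue f" and "0 < e"
  obtains b M r where "b \<in> borel_measurable lebesgue" "0 < M" "\<And>x. cmod (b x) \<le> M"
    "\<And>x. r < norm x \<Longrightarrow> b x = 0" "sq_integrable lebesgue b"
    "l2norm lebesgue (\<lambda>x. b x - f x) < e"
proof -
  define b where "b = (\<lambda>n x. if norm x \<le> real n \<and> cmod (f x) \<le> real n then f x else 0)"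
  have [measurable]: "f \<in> borel_measurable lebesgue" using f by auto
  have [measurable]: "(\<lambda>x::'a. norm x) \<in> borel_measurable lebesgue"
    by (simp add: measurable_completion)
  have bm: "b n \<in> borel_measurable lebesgue" for n
    unfolding b_def by measurable
  have "(\<lambda>n. l2norm lebesgue (\<lambda>x. b n x - f x)) \<longlonglongrightarrow> 0"
  proof (rule l2norm_dominated_convergence)
    show "integrable lebesgue (\<lambda>x. (cmod (f x))\<^sup>2)" using f by (simp add: sq_integrable_def)
    show "(cmod (b n x - f x))\<^sup>2 \<le> (cmod (f x))\<^sup>2" for n x by (simp add: b_def)
    show "AE x in lebesgue. (\<lambda>n. b n x) \<longlonglongrightarrow> f x"
    proof (rule AE_I2)
      fix x
      have "\<forall>\<^sub>F n in sequentially. max (norm x) (cmod (f x)) \<le> real n"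
        using eventually_ge_at_top[of "nat \<lceil>max (norm x) (cmod (f x))\<rceil>"]
        by eventually_elim linarith
      then have "\<forall>\<^sub>F n in sequentially. b n x = f x"
        by eventually_elim (simp add: b_def)
      then show "(\<lambda>n. b n x) \<longlonglongrightarrow> f x" by (rule tendsto_eventually)
    qed
  qed (use bm in auto)
  then have "\<forall>\<^sub>F n in sequentially. l2norm lebesgue (\<lambda>x. b n x - f x) < e"
    using \<open>0 < e\<close> by (rule order_tendstoD)
  then obtain n where n: "l2norm lebesgue (\<lambda>x. b n x - f x) < e"
    by (auto simp: eventually_sequentially)
  show thesis
  \<comment> \<open>The bound is \<open>real n + 1\<close> because \<open>M\<close> must be positive
    and \<open>n\<close> may be 0.\<close>
  proof (rule that[of "b n" "real n + 1" "real n"])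
    show "sq_integrable lebesgue (b n)"
      by (rule sq_integrable_mono[OF f bm, where C = 1]) (simp add: b_def)
  qed (use bm n in \<open>auto simp: b_def\<close>)
qed

text \<open>A Lebesgue measurable function is an almost everywhere limit of continuous functions,
  but these come without control of size or support. Clamping the values and cutting off in space
  provide both, preserve continuity, and make dominated convergence applicable.\<close>

lemma l2_approx_continuous:
  fixes f :: "'a::euclidean_space \<Rightarrow> complex"
  assumes f: "sq_integrable lebesgue f" and "0 < e"
  obtains v M r where "continuous_on UNIV v" "\<And>x. cmod (v x) \<le> M"
    "\<And>x. r < norm x \<Longrightarrow> v x = 0" "l2norm lebesgue (\<lambda>x. v x - f x) < e"
proof -
  obtain b M r where bm [measurable]: "b \<in> borel_measurable lebesgue" and M: "0 < M" "\<And>x. cmod (b x) \<le> M"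
    and supp: "\<And>x. r < norm x \<Longrightarrow> b x = 0" and sb: "sq_integrable lebesgue b"
    and bf: "l2norm lebesgue (\<lambda>x. b x - f x) < e / 2"
    using l2_approx_bounded_support[OF f, of "e / 2"] \<open>0 < e\<close> by auto
  have "b measurable_on UNIV"
    by (rule lebesgue_measurable_imp_measurable_on) (use bm in auto)
  then obtain N g where N: "negligible N" and g: "\<And>n::nat. continuous_on UNIV (g n)"
    and lim: "\<And>x. x \<notin> N \<Longrightarrow> (\<lambda>n. g n x) \<longlonglongrightarrow> b x"
    unfolding measurable_on_def by auto
  \<comment> \<open>The radial retraction onto the disc of radius \<open>M\<close>: it is continuous
    since the denominator is at least \<open>M > 0\<close>, and it fixes the values of
    \<open>b\<close>. The factor \<open>cut\<close> is 1 on the ball of radius \<open>r\<close>,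
    outside which \<open>b\<close> vanishes, and 0 beyond radius \<open>r + 1\<close>.\<close>
  define clamp where "clamp = (\<lambda>c::complex. (M / max M (cmod c)) *\<^sub>R c)"
  define cut where "cut = (\<lambda>x::'a. max 0 (min 1 (r + 1 - norm x)))"
  define v where "v = (\<lambda>n x. cut x *\<^sub>R clamp (g n x))"
  have clamp_le: "cmod (clamp c) \<le> M" for c
    using M(1) by (auto simp: clamp_def max_def field_simps)
  have clamp_id: "clamp c = c" if "cmod c \<le> M" for c
    using M(1) that by (simp add: clamp_def max_def)
  have cont_clamp: "continuous_on UNIV clamp"
    unfolding clamp_def using M(1) by (intro continuous_intros) auto
  have cut: "0 \<le> cut x" "cut x \<le> 1" for x by (auto simp: cut_def)
  have v_le: "cmod (v n x) \<le> M" for n x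
  proof -
    have "cut x * cmod (clamp (g n x)) \<le> 1 * M"
      using cut clamp_le M by (intro mult_mono) auto
    then show ?thesis using cut by (simp add: v_def)
  qed
  have v_supp: "v n x = 0" if "r + 1 < norm x" for n x
    using that by (simp add: v_def cut_def)
  have v_cont: "continuous_on UNIV (v n)" for n
    unfolding v_def cut_def
    by (intro continuous_intros continuous_on_compose2[OF cont_clamp g]) auto
  have vm: "v n \<in> borel_measurable lebesgue" for n
    using borel_measurable_continuous_onI[OF v_cont] by (simp add: measurable_completion)
  have lim: "(\<lambda>n. l2norm lebesgue (\<lambda>x. v n x - b x)) \<longlonglongrightarrow> 0"
  proof (rule l2norm_dominated_convergence)
    show "integrable lebesgue (\<lambda>x. (2 * M)\<^sup>2 * indicator (cball (0::'a) (r + 1)) x)"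
      by (rule integrable_indicator_cball)
    show "(cmod (v n x - b x))\<^sup>2 \<le> (2 * M)\<^sup>2 * indicator (cball 0 (r + 1)) x" for n x
    proof (cases "norm x \<le> r + 1")
      case True
      have "cmod (v n x - b x) \<le> 2 * M"
        using norm_triangle_ineq4[of "v n x" "b x"] v_le[of n x] M(2)[of x] by linarith
      then have "(cmod (v n x - b x))\<^sup>2 \<le> (2 * M)\<^sup>2"
        by (rule power_mono) simp
      then show ?thesis using True by simp
    next
      case False
      then show ?thesis using v_supp[of x n] supp[of x] by simp
    qed
    have "AE x in lebesgue. x \<notin> N"
      using N by (simp add: AE_not_in negligible_iff_null_sets)
    then show "AE x in lebesgue. (\<lambda>n. v n x) \<longlonglongrightarrow> b x"
    proof eventually_elim
      case (elim x)
      have "isCont clamp (b x)"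
        using cont_clamp by (simp add: continuous_on_eq_continuous_at)
      then have "(\<lambda>n. clamp (g n x)) \<longlonglongrightarrow> clamp (b x)"
        by (rule isCont_tendsto_compose) (rule lim[OF elim])
      then have "(\<lambda>n. v n x) \<longlonglongrightarrow> cut x *\<^sub>R clamp (b x)"
        unfolding v_def by (intro tendsto_intros)
      moreover have "cut x *\<^sub>R clamp (b x) = b x"
        using supp[of x] M(2)[of x] by (cases "norm x \<le> r") (auto simp: clamp_id cut_def)
      ultimately show ?case by simp
    qed
  qed (use bm vm in auto)
  then have "\<forall>\<^sub>F n in sequentially. l2norm lebesgue (\<lambda>x. v n x - b x) < e / 2"
    by (rule order_tendstoD) (use \<open>0 < e\<close> in simp)
  then obtain n where n: "l2norm lebesgue (\<lambda>x. v n x - b x) < e / 2"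
    by (auto simp: eventually_sequentially)
  have sv: "sq_integrable lebesgue (v n)"
    unfolding sq_integrable_def
  proof
    show "integrable lebesgue (\<lambda>x. (cmod (v n x))\<^sup>2)"
    proof (rule Bochner_Integration.integrable_bound)
      show "integrable lebesgue (\<lambda>x. M\<^sup>2 * indicator (cball (0::'a) (r + 1)) x)"
        by (rule integrable_indicator_cball)
      show "(\<lambda>x. (cmod (v n x))\<^sup>2) \<in> borel_measurable lebesgue"
        using vm[of n] by measurable
      show "AE x in lebesgue. norm ((cmod (v n x))\<^sup>2) \<le> norm (M\<^sup>2 * indicator (cball 0 (r + 1)) x :: real)"
        using v_le[of n] v_supp[of _ n]
        by (intro AE_I2) (auto simp: indicator_def power_mono not_le)
    qed
  qed (rule vm)
  show thesis
  proof (rule that[of "v n" M "r + 1"])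
    show "l2norm lebesgue (\<lambda>x. v n x - f x) < e"
      using l2norm_triangle_diff[where f = "v n" and g = b and h = f, OF sv sb f] n bf by simp
  qed (use v_cont v_le v_supp in auto)
qed

text \<open>Translation is an isometry, so replacing \<open>f\<close> by a continuous
  \<open>v\<close> of bounded support costs the same before and after the shift; for
  \<open>v\<close> itself dominated convergence applies.\<close>

lemma l2norm_translate_diff_tendsto_0:
  fixes f :: "'a::euclidean_space \<Rightarrow> complex"
  assumes f: "sq_integrable lebesgue f" and s: "s \<longlonglongrightarrow> 0"
  shows "(\<lambda>n. l2norm lebesgue (\<lambda>x. translate (s n) f x - f x)) \<longlonglongrightarrow> 0"
proof (rule LIMSEQ_I)
  fix e :: real assume "0 < e"
  obtain v M r where vc: "continuous_on UNIV v" and M: "\<And>x. cmod (v x) \<le> M"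
    and supp: "\<And>x. r < norm x \<Longrightarrow> v x = 0" and vf: "l2norm lebesgue (\<lambda>x. v x - f x) < e / 3"
    using l2_approx_continuous[OF f, of "e / 3"] \<open>0 < e\<close> by auto
  have vm: "v \<in> borel_measurable lebesgue"
    using borel_measurable_continuous_onI[OF vc] by (simp add: measurable_completion)
  have sv: "sq_integrable lebesgue v"
    unfolding sq_integrable_def
  proof
    show "integrable lebesgue (\<lambda>x. (cmod (v x))\<^sup>2)"
    proof (rule Bochner_Integration.integrable_bound)
      show "integrable lebesgue (\<lambda>x. M\<^sup>2 * indicator (cball (0::'a) r) x)"
        by (rule integrable_indicator_cball)
      show "(\<lambda>x. (cmod (v x))\<^sup>2) \<in> borel_measurable lebesgue"
        using vm by measurable
      show "AE x in lebesgue. norm ((cmod (v x))\<^sup>2) \<le> norm (M\<^sup>2 * indicator (cball 0 r) x :: real)"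
        using M supp by (intro AE_I2) (auto simp: indicator_def power_mono not_le)
    qed
  qed (rule vm)
  \<comment> \<open>Bounded shifts keep all the translates of \<open>v\<close> inside one ball,
    which gives the majorant.\<close>
  obtain S where S: "\<And>n. norm (s n) \<le> S"
    using convergent_imp_Bseq[of s] s by (auto simp: convergent_def Bseq_def)
  have "(\<lambda>n. l2norm lebesgue (\<lambda>x. translate (s n) v x - v x)) \<longlonglongrightarrow> 0"
  proof (rule l2norm_dominated_convergence)
    show "integrable lebesgue (\<lambda>x. (2 * M)\<^sup>2 * indicator (cball (0::'a) (r + S)) x)"
      by (rule integrable_indicator_cball)
    show "(cmod (translate (s n) v x - v x))\<^sup>2 \<le> (2 * M)\<^sup>2 * indicator (cball 0 (r + S)) x" for n x
    proof (cases "norm x \<le> r + S")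
      case True
      have "cmod (translate (s n) v x - v x) \<le> 2 * M"
        using norm_triangle_ineq4[of "v (x - s n)" "v x"] M[of x] M[of "x - s n"]
        unfolding translate_def by linarith
      then have "(cmod (translate (s n) v x - v x))\<^sup>2 \<le> (2 * M)\<^sup>2"
        by (rule power_mono) simp
      then show ?thesis using True by simp
    next
      case False
      then have "r < norm (x - s n)" "r < norm x"
        using norm_triangle_ineq2[of x "s n"] S[of n] norm_ge_zero[of "s n"] by linarith+
      then show ?thesis using supp by (simp add: translate_def)
    qed
    show "AE x in lebesgue. (\<lambda>n. translate (s n) v x) \<longlonglongrightarrow> v x"
    proof (rule AE_I2)
      fix x
      have "isCont v (x - 0)"
        using vc by (simp add: continuous_on_eq_continuous_at)
      then have "(\<lambda>n. v (x - s n)) \<longlonglongrightarrow> v (x - 0)"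
        by (rule isCont_tendsto_compose) (intro tendsto_intros s)
      then show "(\<lambda>n. translate (s n) v x) \<longlonglongrightarrow> v x"
        by (simp add: translate_def)
    qed
  qed (use vm translate_measurable in auto)
  then obtain n0 where n0: "\<And>n. n \<ge> n0 \<Longrightarrow> l2norm lebesgue (\<lambda>x. translate (s n) v x - v x) < e / 3"
    using order_tendstoD(2)[of _ 0 sequentially "e / 3"] \<open>0 < e\<close>
    by (auto simp: eventually_sequentially)
  have "l2norm lebesgue (\<lambda>x. translate (s n) f x - f x) < e" if "n \<ge> n0" for n
  proof -
    let ?T = "translate (s n)"
    have "l2norm lebesgue (\<lambda>x. ?T f x - ?T v x) = l2norm lebesgue (translate (s n) (\<lambda>x. f x - v x))"
      by (simp add: translate_def)
    also have "\<dots> = l2norm lebesgue (\<lambda>x. v x - f x)"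
      using sq_integrable_diff[OF f sv]
      by (subst l2norm_translate) (auto intro: l2norm_minus_commute)
    finally have "l2norm lebesgue (\<lambda>x. ?T f x - ?T v x) < e / 3" using vf by simp
    moreover have "l2norm lebesgue (\<lambda>x. ?T f x - f x)
        \<le> l2norm lebesgue (\<lambda>x. ?T f x - ?T v x) + l2norm lebesgue (\<lambda>x. ?T v x - f x)"
      by (intro l2norm_triangle_diff sq_integrable_translate f sv)
    moreover have "l2norm lebesgue (\<lambda>x. ?T v x - f x)
        \<le> l2norm lebesgue (\<lambda>x. ?T v x - v x) + l2norm lebesgue (\<lambda>x. v x - f x)"
      by (intro l2norm_triangle_diff sq_integrable_translate f sv)
    ultimately show ?thesis using vf n0[OF that] by linarith
  qed
  then show "\<exists>n0. \<forall>n\<ge>n0. norm (l2norm lebesgue (\<lambda>x. translate (s n) f x - f x) - 0) < e"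
    by auto
qed

section \<open>The Gaussian\<close>

definition phase :: "real \<Rightarrow> complex" where
  "phase t = exp (- 2 * of_real pi * \<i> * of_real t)"

lemma norm_phase [simp]: "cmod (phase t) = 1"
  unfolding phase_def using norm_exp_i_times[of "- 2 * pi * t"]
  by (simp add: mult_ac)

lemma phase_0 [simp]: "phase 0 = 1"
  by (simp add: phase_def)

lemma phase_add: "phase (s + t) = phase s * phase t"
  unfolding phase_def exp_add[symmetric] by (simp add: algebra_simps)

lemma cnj_phase: "cnj (phase t) = phase (- t)"
  unfolding phase_def exp_cnj by simp

lemma phase_diff: "phase (s - t) = phase s * cnj (phase t)"
  using phase_add[of s "- t"] by (simp add: cnj_phase)

lemma phase_sum: "finite A \<Longrightarrow> phase (\<Sum>i\<in>A. f i) = (\<Prod>i\<in>A. phase (f i))"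
  by (induction A rule: finite_induct) (simp_all add: phase_add)

lemma phase_measurable [measurable]: "phase \<in> borel_measurable borel"
  unfolding phase_def by (intro borel_measurable_continuous_onI continuous_intros)

lemma fourier_phase: "fourier f w = (LINT x|lebesgue. f x * phase (x \<bullet> w))"
  by (simp add: fourier_def phase_def)

text \<open>A rescaling of the characteristic function of the standard normal distribution.\<close>

lemma integral_gaussian_phase_real:
  assumes "0 < s"
  shows "(LINT t|lborel. of_real (exp (- pi * s\<^sup>2 * t\<^sup>2)) * phase (t * y)) =
    of_real (exp (- pi * y\<^sup>2 / s\<^sup>2) / s)"
proof -
  \<comment> \<open>With this \<open>c\<close> the exponent \<open>(c * t)\<^sup>2 / 2\<close> is
    \<open>pi * s\<^sup>2 * t\<^sup>2\<close>, and \<tau> is chosen so that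
    \<open>\<tau> * c = - 2 * pi * y\<close>.\<close>
  define c where "c = sqrt (2 * pi) * s"
  define \<tau> where "\<tau> = - (2 * pi * y) / c"
  have c: "0 < c" "c\<^sup>2 = 2 * pi * s\<^sup>2"
    using assms by (simp_all add: c_def power_mult_distrib)
  have "of_real (exp (- pi * y\<^sup>2 / s\<^sup>2)) = char std_normal_distribution \<tau>"
  proof -
    have "\<tau>\<^sup>2 / 2 = pi * y\<^sup>2 / s\<^sup>2"
      unfolding \<tau>_def power_divide c(2) power2_minus power_mult_distrib
      using assms by (simp add: field_simps power2_eq_square)
    then show ?thesis by (simp add: char_std_normal_distribution)
  qed
  also have "\<dots> = (LINT t|lborel. std_normal_density t *\<^sub>R iexp (\<tau> * t))"
    unfolding char_def by (subst integral_density) auto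
  also have "\<dots> = c *\<^sub>R (LINT t|lborel. std_normal_density (0 + c * t) *\<^sub>R iexp (\<tau> * (0 + c * t)))"
    using c by (subst lborel_integral_real_affine[where c = c and t = 0]) auto
  also have "\<dots> = c *\<^sub>R (LINT t|lborel. of_real (1 / sqrt (2 * pi)) *
      (of_real (exp (- pi * s\<^sup>2 * t\<^sup>2)) * phase (t * y)))"
  proof (intro arg_cong[where f = "\<lambda>z. c *\<^sub>R z"] Bochner_Integration.integral_cong refl)
    fix t
    have "std_normal_density (0 + c * t) = 1 / sqrt (2 * pi) * exp (- pi * s\<^sup>2 * t\<^sup>2)"
      by (simp add: std_normal_density_def power_mult_distrib c(2))
    moreover have "iexp (\<tau> * (0 + c * t)) = phase (t * y)"
      using c by (simp add: phase_def \<tau>_def mult_ac)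
    ultimately show "std_normal_density (0 + c * t) *\<^sub>R iexp (\<tau> * (0 + c * t)) =
        of_real (1 / sqrt (2 * pi)) * (of_real (exp (- pi * s\<^sup>2 * t\<^sup>2)) * phase (t * y))"
      by (simp add: scaleR_conv_of_real)
  qed
  also have "\<dots> = of_real s * (LINT t|lborel. of_real (exp (- pi * s\<^sup>2 * t\<^sup>2)) * phase (t * y))"
    by (simp add: c_def scaleR_conv_of_real)
  finally show ?thesis
    using assms by (simp add: field_simps)
qed

text \<open>The factor \<open>pi\<close> keeps the family closed under the Fourier transform:
  \<open>s\<close> becomes \<open>1 / s\<close>, with weight \<open>1 / s ^ DIM('a)\<close>. A small
  \<open>s\<close> means a wide Gaussian, so damping disappears as \<open>s\<close> tends to
  0.\<close>

definition gaussian :: "real \<Rightarrow> 'a::euclidean_space \<Rightarrow> real" where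
  "gaussian s w = exp (- pi * s\<^sup>2 * (norm w)\<^sup>2)"

lemma gaussian_measurable [measurable]: "gaussian s \<in> borel_measurable borel"
  unfolding gaussian_def by measurable

lemma gaussian_nonneg [simp]: "0 \<le> gaussian s w"
  by (simp add: gaussian_def)

lemma gaussian_scale: "gaussian s (c *\<^sub>R w) = gaussian (s * c) w"
  by (simp add: gaussian_def power_mult_distrib mult_ac)

text \<open>Gaussian and character both factor over the coordinates, and \<open>lborel\<close> is
  the image of a product measure, so the integral is a product of one-dimensional ones.\<close>

lemma integral_gaussian_phase:
  fixes x :: "'a::euclidean_space"
  assumes "0 < s"
  shows "(LINT w|lborel. of_real (gaussian s w) * phase (x \<bullet> w)) =
    of_real (gaussian (1 / s) x / s ^ DIM('a))"
proof -
  define F where "F = (\<lambda>b t. complex_of_real (exp (- pi * s\<^sup>2 * t\<^sup>2)) * phase (t * (x \<bullet> b)))"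
  have norm2: "(norm w)\<^sup>2 = (\<Sum>b\<in>Basis. (w \<bullet> b)\<^sup>2)" for w :: 'a
    by (subst power2_norm_eq_inner, subst euclidean_inner) (simp add: power2_eq_square)
  have gauss: "gaussian r w = (\<Prod>b\<in>Basis. exp (- pi * r\<^sup>2 * (w \<bullet> b)\<^sup>2))" for w :: 'a and r
    by (simp add: gaussian_def norm2 sum_distrib_left exp_sum flip: sum_negf)
  have split: "of_real (gaussian s w) * phase (x \<bullet> w) = (\<Prod>b\<in>Basis. F b (w \<bullet> b))" for w :: 'a
  proof -
    have "phase (x \<bullet> w) = (\<Prod>b\<in>Basis. phase ((w \<bullet> b) * (x \<bullet> b)))"
      by (simp add: euclidean_inner[of x w] phase_sum mult.commute)
    then show ?thesis
      by (simp add: gauss F_def prod.distrib)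
  qed
  interpret P: product_sigma_finite "\<lambda>_::'a. lborel :: real measure"
    by standard
  have Fint: "(LINT t|lborel. F b t) = of_real (exp (- pi * (x \<bullet> b)\<^sup>2 / s\<^sup>2) / s)" for b
    unfolding F_def by (rule integral_gaussian_phase_real[OF assms])
  \<comment> \<open>Bochner integrals of non-integrable functions are 0, so the nonzero value implies integrability.\<close>
  have Fi: "integrable lborel (F b)" for b
    using Fint[of b] assms by (intro ccontr[of "integrable lborel (F b)"])
      (simp add: not_integrable_integral_eq)
  have [measurable]: "\<And>b. F b \<in> borel_measurable borel"
    unfolding F_def by measurable
  have "(LINT w|lborel. of_real (gaussian s w) * phase (x \<bullet> w)) =
      (LINT w|(distr (\<Pi>\<^sub>M b\<in>Basis. lborel) borel (\<lambda>f. \<Sum>b\<in>Basis. f b *\<^sub>R b)). (\<Prod>b\<in>Basis. F b (w \<bullet> b)))"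
    unfolding split by (subst lborel_eq) (rule refl)
  also have "\<dots> = (LINT f|(\<Pi>\<^sub>M b\<in>Basis. lborel). (\<Prod>b\<in>Basis. F b ((\<Sum>b\<in>Basis. f b *\<^sub>R b) \<bullet> (b::'a))))"
    by (rule integral_distr) measurable
  also have "\<dots> = (LINT f|(\<Pi>\<^sub>M b\<in>Basis. lborel). (\<Prod>b\<in>(Basis::'a set). F b (f b)))"
    by (intro Bochner_Integration.integral_cong prod.cong refl) (simp add: inner_sum_left_Basis)
  also have "\<dots> = (\<Prod>b\<in>(Basis::'a set). LINT t|lborel. F b t)"
    by (rule P.product_integral_prod) (use Fi in auto)
  also have "\<dots> = of_real (gaussian (1 / s) x / s ^ DIM('a))"
    by (simp add: Fint gauss prod_dividef power_divide)
  finally show ?thesis .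
qed

lemma
  assumes "0 < s"
  shows integral_gaussian:
      "(LINT w|lborel. gaussian s (w::'a::euclidean_space)) = 1 / s ^ DIM('a)"
    and integrable_gaussian: "integrable lborel (gaussian s :: 'a \<Rightarrow> real)"
proof -
  have "of_real (LINT w|lborel. gaussian s (w::'a)) = (of_real (1 / s ^ DIM('a)) :: complex)"
    using integral_gaussian_phase[OF assms, of "0::'a"] by (simp add: gaussian_def)
  then show eq: "(LINT w|lborel. gaussian s (w::'a)) = 1 / s ^ DIM('a)"
    by (simp only: of_real_eq_iff)
  show "integrable lborel (gaussian s :: 'a \<Rightarrow> real)"
  proof (rule ccontr)
    assume "\<not> integrable lborel (gaussian s :: 'a \<Rightarrow> real)"
    then show False using eq assms not_integrable_integral_eq by fastforce
  qed
qed

section \<open>Plancherel's theorem on the intersection of L1 and L2\<close>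

text \<open>Provides the majorants for interchanging a frequency integral with a space
  integral.\<close>

lemma integrable_lborel_prod_mult:
  fixes f :: "'a::euclidean_space \<Rightarrow> complex" and g :: "'b::euclidean_space \<Rightarrow> complex"
  assumes f: "integrable lborel f" and g: "integrable lborel g"
  shows "integrable (lborel \<Otimes>\<^sub>M lborel) (\<lambda>(x, y). f x * g y)"
proof -
  have [measurable]: "f \<in> borel_measurable borel" "g \<in> borel_measurable borel"
    using f g by auto
  show ?thesis
  proof (rule lborel_pair.Fubini_integrable)
    show "(\<lambda>(x, y). f x * g y) \<in> borel_measurable (lborel \<Otimes>\<^sub>M lborel)" by measurable
    have "integrable lborel (\<lambda>x. cmod (f x) * (LINT y|lborel. cmod (g y)))"
      using f by simp
    then show "integrable lborel (\<lambda>x. LINT y|lborel. norm (case (x, y) of (x, y) \<Rightarrow> f x * g y))"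
      by (simp add: norm_mult)
    show "AE x in lborel. integrable lborel (\<lambda>y. case (x, y) of (x, y) \<Rightarrow> f x * g y)"
      using g by simp
  qed
qed

text \<open>
  Fubini's theorem is used for Borel functions with respect to \<^const>\<open>lborel\<close>, since for a Lebesgue
  measurable \<open>u\<close> the map \<open>(z, x) \<mapsto> u (x - z)\<close> need not be measurable for the product of two copies
  of \<^const>\<open>lebesgue\<close>.
\<close>

context
  fixes u :: "'a::euclidean_space \<Rightarrow> complex"
  assumes um [measurable]: "u \<in> borel_measurable borel"
    and u1: "integrable lborel u" and u2: "sq_integrable lborel u"
begin

definition ft :: "'a \<Rightarrow> complex" where "ft w = (LINT x|lborel. u x * phase (x \<bullet> w))"

definition autocorr :: "'a \<Rightarrow> complex" where
  "autocorr z = (LINT x|lborel. u x * cnj (u (x - z)))"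

lemma cnj_u_measurable [measurable]: "(\<lambda>x. cnj (u x)) \<in> borel_measurable borel"
  using um by (simp add: borel_measurable_complex_iff)

lemma ft_measurable [measurable]: "ft \<in> borel_measurable borel"
  unfolding ft_def by measurable

lemma cnj_ft_measurable [measurable]: "(\<lambda>x. cnj (ft x)) \<in> borel_measurable borel"
  using ft_measurable by (simp add: borel_measurable_complex_iff)

lemma norm_ft_le: "cmod (ft w) \<le> (LINT x|lborel. cmod (u x))"
  unfolding ft_def using integral_norm_bound[of lborel "\<lambda>x. u x * phase (x \<bullet> w)"]
  by (simp add: norm_mult)

lemma sq_integrable_shift_lborel: "sq_integrable lborel (\<lambda>x. u (x - z))"
  and l2norm_shift_lborel: "l2norm lborel (\<lambda>x. u (x - z)) = l2norm lborel u"
proof -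
  have "(\<lambda>x. (cmod (u x))\<^sup>2) \<in> borel_measurable borel" by measurable
  note * = lborel_integral_affine[OF this, of 1 "- z"] lborel_integrable_affine_iff[OF this, of 1 "- z"]
  then show "sq_integrable lborel (\<lambda>x. u (x - z))" "l2norm lborel (\<lambda>x. u (x - z)) = l2norm lborel u"
    using u2 by (simp_all add: sq_integrable_def l2norm_def)
qed

lemma norm_autocorr_le: "cmod (autocorr z) \<le> (l2norm lborel u)\<^sup>2"
proof -
  have "l2norm lborel (\<lambda>x. cnj (u (x - z))) = l2norm lborel u"
    using l2norm_shift_lborel[of z] by (simp add: l2norm_def)
  then show ?thesis
    unfolding autocorr_def
    using l2_Cauchy_Schwarz[OF u2 sq_integrable_cnj[OF sq_integrable_shift_lborel[of z]]]
    by (simp add: power2_eq_square)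
qed

lemma autocorr_measurable [measurable]: "autocorr \<in> borel_measurable borel"
  unfolding autocorr_def by measurable

text \<open>After writing the conjugate transform as an integral over \<open>y\<close>, the phases
  combine to the character at \<open>x - y\<close>, and the frequency integral becomes the transform
  of a Gaussian. The result is the convolution of the conjugate of \<open>u\<close> with a Gaussian
  kernel.\<close>

lemma integral_cnj_ft_gaussian:
  assumes s: "0 < s"
  shows "(LINT w|lborel. cnj (ft w) * of_real (gaussian s w) * phase (x \<bullet> w)) =
    (LINT z|lborel. cnj (u (x - z)) * of_real (gaussian (1 / s) z / s ^ DIM('a)))"
proof -
  let ?f = "\<lambda>w y. cnj (u y) * of_real (gaussian s w) * phase ((x - y) \<bullet> w)"
  have int: "integrable (lborel \<Otimes>\<^sub>M lborel) (\<lambda>(w, y). ?f w y)"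
  proof (rule Bochner_Integration.integrable_bound)
    show "integrable (lborel \<Otimes>\<^sub>M lborel) (\<lambda>(w::'a, y). complex_of_real (gaussian s w) * u y)"
      by (rule integrable_lborel_prod_mult) (use u1 integrable_gaussian[OF s] in auto)
    show "(\<lambda>(w, y). ?f w y) \<in> borel_measurable (lborel \<Otimes>\<^sub>M lborel)" by measurable
  qed (auto simp: norm_mult)
  have "(LINT w|lborel. cnj (ft w) * of_real (gaussian s w) * phase (x \<bullet> w)) =
      (LINT w|lborel. LINT y|lborel. ?f w y)"
  proof (intro Bochner_Integration.integral_cong refl)
    fix w :: 'a
    have "cnj (ft w) = (LINT y|lborel. cnj (u y * phase (y \<bullet> w)))"
      unfolding ft_def by (rule Bochner_Integration.integral_cnj[symmetric])
    then have "cnj (ft w) * of_real (gaussian s w) * phase (x \<bullet> w) =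
        (LINT y|lborel. cnj (u y * phase (y \<bullet> w)) * (of_real (gaussian s w) * phase (x \<bullet> w)))"
      by (simp only: mult.assoc integral_mult_left_zero)
    also have "\<dots> = (LINT y|lborel. ?f w y)"
      by (intro Bochner_Integration.integral_cong refl) (simp add: inner_diff_left phase_diff mult_ac)
    finally show "cnj (ft w) * of_real (gaussian s w) * phase (x \<bullet> w) = (LINT y|lborel. ?f w y)" .
  qed
  also have "\<dots> = (LINT y|lborel. LINT w|lborel. ?f w y)"
    by (rule lborel_pair.Fubini_integral[OF int, symmetric])
  also have "\<dots> = (LINT y|lborel. cnj (u y) * of_real (gaussian (1 / s) (x - y) / s ^ DIM('a)))"
    using integral_gaussian_phase[OF s, where 'a = 'a]
    by (intro Bochner_Integration.integral_cong refl) (simp add: mult.assoc)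
  also have "\<dots> = (LINT z|lborel. cnj (u (x - z)) * of_real (gaussian (1 / s) z / s ^ DIM('a)))"
    by (subst lborel_integral_affine[where c = "- 1" and t = x]) simp_all
  finally show ?thesis .
qed

text \<open>The damped Plancherel identity. One factor \<open>ft w\<close> is written as an integral
  over \<open>x\<close>, which leaves its conjugate to be integrated against the Gaussian as in
  \<open>integral_cnj_ft_gaussian\<close>; exchanging \<open>x\<close> and \<open>z\<close> then
  forms \<open>autocorr\<close>.\<close>

lemma integral_ft_gaussian:
  assumes s: "0 < s"
  shows "(LINT w|lborel. of_real ((cmod (ft w))\<^sup>2 * gaussian s w)) =
    (LINT z|lborel. autocorr (s *\<^sub>R z) * of_real (gaussian 1 z))"
proof -
  \<comment> \<open>The transform of the damping factor: a kernel of total mass 1 that concentrates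
    at 0 as \<open>s\<close> tends to 0.\<close>
  define k where "k = (\<lambda>z::'a. gaussian (1 / s) z / s ^ DIM('a))"
  have [measurable]: "k \<in> borel_measurable borel"
    unfolding k_def by measurable
  have k: "integrable lborel k" "\<And>z. 0 \<le> k z"
    using integrable_gaussian[of "1 / s", where 'a = 'a] s
    by (simp_all add: k_def)
  let ?f = "\<lambda>x w. u x * (cnj (ft w) * of_real (gaussian s w) * phase (x \<bullet> w))"
  have int: "integrable (lborel \<Otimes>\<^sub>M lborel) (\<lambda>(x, w). ?f x w)"
  proof (rule Bochner_Integration.integrable_bound)
    show "integrable (lborel \<Otimes>\<^sub>M lborel)
        (\<lambda>(x, w::'a). u x * of_real ((LINT x|lborel. cmod (u x)) * gaussian s w))"
      by (rule integrable_lborel_prod_mult) (use u1 integrable_gaussian[OF s] in auto)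
    show "(\<lambda>(x, w). ?f x w) \<in> borel_measurable (lborel \<Otimes>\<^sub>M lborel)" by measurable
    show "AE x in lborel \<Otimes>\<^sub>M lborel. norm (case x of (x, w) \<Rightarrow> ?f x w)
        \<le> norm (case x of (x, w) \<Rightarrow> u x * complex_of_real ((LINT x|lborel. cmod (u x)) * gaussian s w))"
      using norm_ft_le order_trans[OF norm_ge_zero norm_ft_le]
      by (intro AE_I2) (auto simp: norm_mult abs_mult intro!: mult_left_mono mult_right_mono)
  qed
  let ?g = "\<lambda>z x. u x * cnj (u (x - z)) * of_real (k z)"
  have sq: "integrable lborel (\<lambda>x. u x * cnj (u (x - z)))" for z
    by (intro sq_integrable_mult_integrable u2 sq_integrable_cnj sq_integrable_shift_lborel)
  \<comment> \<open>Cauchy-Schwarz in \<open>x\<close> bounds the inner integral by the squared norm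
    of \<open>u\<close> uniformly in \<open>z\<close>, and \<open>k\<close> makes the outer integral
    finite.\<close>
  have int2: "integrable (lborel \<Otimes>\<^sub>M lborel) (\<lambda>(z, x). ?g z x)"
  proof (rule lborel_pair.Fubini_integrable)
    show "(\<lambda>(z, x). ?g z x) \<in> borel_measurable (lborel \<Otimes>\<^sub>M lborel)" by measurable
    show "integrable lborel (\<lambda>z. LINT x|lborel. norm (case (z, x) of (z, x) \<Rightarrow> ?g z x))"
    proof (rule Bochner_Integration.integrable_bound)
      show "integrable lborel (\<lambda>z. (l2norm lborel u)\<^sup>2 * k z)"
        using k by simp
      show "(\<lambda>z. LINT x|lborel. norm (case (z, x) of (z, x) \<Rightarrow> ?g z x)) \<in> borel_measurable lborel"
        by measurable
      show "AE z in lborel. norm (LINT x|lborel. norm (case (z, x) of (z, x) \<Rightarrow> ?g z x))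
          \<le> norm ((l2norm lborel u)\<^sup>2 * k z)"
      proof (rule AE_I2)
        fix z :: 'a
        have "(LINT x|lborel. cmod (u x) * cmod (u (x - z))) \<le> (l2norm lborel u)\<^sup>2"
          using l2_Cauchy_Schwarz_norm[OF u2 sq_integrable_shift_lborel[of z]]
          by (simp add: l2norm_shift_lborel power2_eq_square)
        then show "norm (LINT x|lborel. norm (case (z, x) of (z, x) \<Rightarrow> ?g z x))
            \<le> norm ((l2norm lborel u)\<^sup>2 * k z)"
          using k(2)[of z] by (simp add: norm_mult abs_mult mult_right_mono)
      qed
    qed
    show "AE z in lborel. integrable lborel (\<lambda>x. case (z, x) of (z, x) \<Rightarrow> ?g z x)"
      using sq by simp
  qed
  have "(LINT w|lborel. of_real ((cmod (ft w))\<^sup>2 * gaussian s w)) = (LINT w|lborel. LINT x|lborel. ?f x w)"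
  proof (intro Bochner_Integration.integral_cong refl)
    fix w :: 'a
    have "of_real ((cmod (ft w))\<^sup>2 * gaussian s w) = ft w * (cnj (ft w) * of_real (gaussian s w))"
      by (simp only: of_real_mult complex_norm_square mult.assoc)
    also have "\<dots> = (LINT x|lborel. u x * phase (x \<bullet> w) * (cnj (ft w) * of_real (gaussian s w)))"
      by (simp add: ft_def)
    also have "\<dots> = (LINT x|lborel. ?f x w)"
      by (simp add: mult_ac)
    finally show "of_real ((cmod (ft w))\<^sup>2 * gaussian s w) = (LINT x|lborel. ?f x w)" .
  qed
  also have "\<dots> = (LINT x|lborel. LINT w|lborel. ?f x w)"
    by (rule lborel_pair.Fubini_integral[OF int])
  also have "\<dots> = (LINT x|lborel. u x * (LINT z|lborel. cnj (u (x - z)) * of_real (k z)))"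
    by (simp only: integral_mult_right_zero integral_cnj_ft_gaussian[OF s] k_def)
  also have "\<dots> = (LINT x|lborel. LINT z|lborel. ?g z x)"
    by (simp only: integral_mult_right_zero[symmetric] mult.assoc)
  also have "\<dots> = (LINT z|lborel. LINT x|lborel. ?g z x)"
    by (rule lborel_pair.Fubini_integral[OF int2])
  also have "\<dots> = (LINT z|lborel. autocorr z * of_real (k z))"
    by (simp add: autocorr_def)
  \<comment> \<open>Rescaling moves \<open>s\<close> from the kernel into the argument of
    \<open>autocorr\<close>, and the Jacobian cancels the normalisation of \<open>k\<close>. The
    weight is then independent of \<open>s\<close>, as suits dominated convergence.\<close>
  also have "\<dots> = s ^ DIM('a) *\<^sub>R (LINT z|lborel. autocorr (0 + s *\<^sub>R z) * of_real (k (0 + s *\<^sub>R z)))"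
    using s by (subst lborel_integral_affine[where c = s and t = 0]) simp_all
  also have "\<dots> = (LINT z|lborel. autocorr (s *\<^sub>R z) * of_real (gaussian 1 z))"
  proof -
    have k_scale: "complex_of_real (k (0 + s *\<^sub>R z)) = of_real (gaussian 1 z) * of_real (1 / s ^ DIM('a))" for z
      using s by (simp add: k_def gaussian_scale)
    show ?thesis
      unfolding k_scale mult.assoc[symmetric] integral_mult_left_zero
      using s by (simp add: scaleR_conv_of_real)
  qed
  finally show ?thesis .
qed

text \<open>The difference from the limit is the inner product of \<open>u\<close> with
  \<open>u (x - r n) - u x\<close>, so Cauchy-Schwarz reduces the claim to continuity of translation
  in L2.\<close>

lemma autocorr_tendsto:
  assumes "r \<longlonglongrightarrow> 0"
  shows "(\<lambda>n. autocorr (r n)) \<longlonglongrightarrow> of_real ((l2norm lborel u)\<^sup>2)"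
proof -
  have ul: "sq_integrable lebesgue u"
    using u2 by (simp add: sq_integrable_def integrable_completion measurable_completion)
  have norm_eq: "l2norm lebesgue f = l2norm lborel f" if "f \<in> borel_measurable borel" for f :: "'a \<Rightarrow> complex"
    unfolding l2norm_def using that by (subst integral_completion) auto
  have "(\<lambda>n. l2norm lebesgue (\<lambda>x. translate (r n) u x - u x)) \<longlonglongrightarrow> 0"
    by (rule l2norm_translate_diff_tendsto_0[OF ul assms])
  then have lim: "(\<lambda>n. l2norm lborel u * l2norm lborel (\<lambda>x. u (x - r n) - u x)) \<longlonglongrightarrow> 0"
    by (intro tendsto_mult_right_zero) (simp add: norm_eq translate_def)
  have "cmod (autocorr (r n) - of_real ((l2norm lborel u)\<^sup>2))
      \<le> l2norm lborel u * l2norm lborel (\<lambda>x. u (x - r n) - u x)" for n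
  proof -
    have diff: "sq_integrable lborel (\<lambda>x. u (x - r n) - u x)"
      by (intro sq_integrable_diff u2 sq_integrable_shift_lborel)
    have "of_real ((l2norm lborel u)\<^sup>2) = (LINT x|lborel. u x * cnj (u x))"
      by (simp only: l2norm_power2 complex_norm_square[symmetric] integral_complex_of_real)
    then have "autocorr (r n) - of_real ((l2norm lborel u)\<^sup>2) =
        (LINT x|lborel. u x * cnj (u (x - r n)) - u x * cnj (u x))"
      unfolding autocorr_def
      by (subst Bochner_Integration.integral_diff)
        (auto intro!: sq_integrable_mult_integrable u2 sq_integrable_cnj sq_integrable_shift_lborel)
    also have "\<dots> = (LINT x|lborel. u x * cnj (u (x - r n) - u x))"
      by (simp add: algebra_simps)
    also have "cmod \<dots> \<le> l2norm lborel u * l2norm lborel (\<lambda>x. cnj (u (x - r n) - u x))"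
      by (intro l2_Cauchy_Schwarz u2 sq_integrable_cnj diff)
    also have "l2norm lborel (\<lambda>x. cnj (u (x - r n) - u x)) = l2norm lborel (\<lambda>x. u (x - r n) - u x)"
      unfolding l2norm_def complex_mod_cnj ..
    finally show ?thesis .
  qed
  then have "(\<lambda>n. autocorr (r n) - of_real ((l2norm lborel u)\<^sup>2)) \<longlonglongrightarrow> 0"
    by (intro Lim_null_comparison[OF always_eventually lim]) simp
  then show ?thesis by (simp add: LIM_zero_iff)
qed

text \<open>As the damping is removed, the right-hand side of \<open>integral_ft_gaussian\<close>
  tends to the squared norm of \<open>u\<close> by dominated convergence. Monotone convergence on
  the left-hand side then gives both integrability and the value of the limit.\<close>

lemma plancherel_lborel:
  shows "sq_integrable lborel ft" and "l2norm lborel ft = l2norm lborel u"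
proof -
  \<comment> \<open>The parameters decrease, so that the damped integrands increase.\<close>
  define s where "s = (\<lambda>n. 1 / real (Suc n))"
  have s: "\<And>n. 0 < s n" "s \<longlonglongrightarrow> 0" "decseq s"
    unfolding s_def using LIMSEQ_inverse_real_of_nat
    by (auto simp: inverse_eq_divide decseq_def frac_le)
  define N where "N = (l2norm lborel u)\<^sup>2"
  have "(\<lambda>n. LINT z|lborel. autocorr (s n *\<^sub>R z) * of_real (gaussian 1 z)) \<longlonglongrightarrow>
      (LINT z|lborel. of_real N * of_real (gaussian 1 (z::'a)))"
  proof (rule integral_dominated_convergence)
    show "integrable lborel (\<lambda>z::'a. N * gaussian 1 z)"
      using integrable_gaussian[of 1, where 'a = 'a] by simp
    show "AE z in lborel. (\<lambda>n. autocorr (s n *\<^sub>R z) * of_real (gaussian 1 z)) \<longlonglongrightarrow>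
        of_real N * of_real (gaussian 1 z)"
    proof (rule AE_I2)
      fix z :: 'a
      have "(\<lambda>n. s n *\<^sub>R z) \<longlonglongrightarrow> 0 *\<^sub>R z"
        by (rule tendsto_scaleR[OF s(2) tendsto_const])
      then have "(\<lambda>n. s n *\<^sub>R z) \<longlonglongrightarrow> 0" by simp
      from autocorr_tendsto[OF this]
      show "(\<lambda>n. autocorr (s n *\<^sub>R z) * of_real (gaussian 1 z)) \<longlonglongrightarrow> of_real N * of_real (gaussian 1 z)"
        unfolding N_def by (intro tendsto_intros)
    qed
    show "AE z in lborel. norm (autocorr (s n *\<^sub>R z) * of_real (gaussian 1 z)) \<le> N * gaussian 1 z" for n
      using norm_autocorr_le
      by (intro AE_I2) (auto simp: norm_mult N_def intro!: mult_right_mono)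
  qed measurable
  also have "(LINT z|lborel. of_real N * of_real (gaussian 1 (z::'a))) = complex_of_real N"
    using integral_gaussian[of 1, where 'a = 'a] by (simp flip: of_real_mult)
  finally have "(\<lambda>n. complex_of_real (LINT w|lborel. (cmod (ft w))\<^sup>2 * gaussian (s n) w)) \<longlonglongrightarrow> of_real N"
    by (simp only: integral_ft_gaussian[OF s(1), symmetric] integral_complex_of_real)
  then have lim: "(\<lambda>n. LINT w|lborel. (cmod (ft w))\<^sup>2 * gaussian (s n) w) \<longlonglongrightarrow> N"
    by (simp only: tendsto_of_real_iff)
  \<comment> \<open>For fixed \<open>n\<close> this uses that \<open>ft\<close> is bounded by the L1
    norm of \<open>u\<close>.\<close>
  have gi: "integrable lborel (\<lambda>w. (cmod (ft w))\<^sup>2 * gaussian (s n) w)" for n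
  proof (rule Bochner_Integration.integrable_bound)
    show "integrable lborel (\<lambda>w::'a. (LINT x|lborel. cmod (u x))\<^sup>2 * gaussian (s n) w)"
      using integrable_gaussian[OF s(1), where 'a = 'a] by simp
    show "AE w in lborel. norm ((cmod (ft w))\<^sup>2 * gaussian (s n) w)
        \<le> norm ((LINT x|lborel. cmod (u x))\<^sup>2 * gaussian (s n) w)"
      using norm_ft_le
      by (intro AE_I2) (auto simp: abs_mult intro!: mult_right_mono power_mono)
  qed measurable
  have mono: "AE w in lborel. mono (\<lambda>n. (cmod (ft w))\<^sup>2 * gaussian (s n) w)"
  proof (rule AE_I2, rule monoI)
    fix w :: 'a and m n :: nat assume "m \<le> n"
    then have "(s n)\<^sup>2 \<le> (s m)\<^sup>2"
      using s(1)[of n] s(3) by (intro power_mono) (auto simp: decseq_def)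
    then have "gaussian (s m) w \<le> gaussian (s n) w"
      by (simp add: gaussian_def mult_right_mono)
    then show "(cmod (ft w))\<^sup>2 * gaussian (s m) w \<le> (cmod (ft w))\<^sup>2 * gaussian (s n) w"
      by (simp add: mult_left_mono)
  qed
  have ptw: "AE w in lborel. (\<lambda>n. (cmod (ft w))\<^sup>2 * gaussian (s n) w) \<longlonglongrightarrow> (cmod (ft w))\<^sup>2"
  proof (rule AE_I2)
    fix w :: 'a
    have "(\<lambda>n. (cmod (ft w))\<^sup>2 * exp (- pi * (s n)\<^sup>2 * (norm w)\<^sup>2)) \<longlonglongrightarrow>
        (cmod (ft w))\<^sup>2 * exp (- pi * 0\<^sup>2 * (norm w)\<^sup>2)"
      by (intro tendsto_intros s)
    then show "(\<lambda>n. (cmod (ft w))\<^sup>2 * gaussian (s n) w) \<longlonglongrightarrow> (cmod (ft w))\<^sup>2"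
      by (simp add: gaussian_def)
  qed
  have ftm: "(\<lambda>w. (cmod (ft w))\<^sup>2) \<in> borel_measurable lborel" by measurable
  show "sq_integrable lborel ft"
    using integrable_monotone_convergence[OF gi mono ptw lim ftm] by (simp add: sq_integrable_def)
  have "(l2norm lborel ft)\<^sup>2 = (l2norm lborel u)\<^sup>2"
    using integral_monotone_convergence[OF gi mono ptw lim ftm] by (simp add: l2norm_power2 N_def)
  then show "l2norm lborel ft = l2norm lborel u"
    by (rule power2_eq_imp_eq) simp_all
qed

end

theorem plancherel_L1_L2:
  fixes u :: "'a::euclidean_space \<Rightarrow> complex"
  assumes u1: "integrable lebesgue u" and u2: "sq_integrable lebesgue u"
  shows "sq_integrable lebesgue (fourier u)" and "l2norm lebesgue (fourier u) = l2norm lebesgue u"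
proof -
  have um: "u \<in> borel_measurable lebesgue" using u2 by auto
  obtain v where v [measurable]: "v \<in> borel_measurable borel" and ae: "AE x in lebesgue. u x = v x"
    using borel_representative[OF um] by blast
  have vm: "v \<in> borel_measurable lebesgue"
    by (simp add: measurable_completion)
  have v1: "integrable lborel v"
    using integrable_cong_AE[OF um vm ae] u1 by (simp add: integrable_completion)
  have v2': "sq_integrable lebesgue v"
    using sq_integrable_cong_AE[OF ae um vm] u2 by simp
  have v2: "sq_integrable lborel v"
    using v2' by (simp add: sq_integrable_def integrable_completion)
  \<comment> \<open>Equality holds at every frequency, since changing \<open>u\<close> on a null set
    changes no integral.\<close>
  have eq: "fourier u = ft v"
  proof
    fix w :: 'a
    have ph: "(\<lambda>x. phase (x \<bullet> w)) \<in> borel_measurable lebesgue"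
      by (rule measurable_completion) measurable
    have "fourier u w = (LINT x|lebesgue. v x * phase (x \<bullet> w))"
      unfolding fourier_phase using ae um vm ph
      by (intro integral_cong_AE) (auto elim: AE_mp)
    also have "\<dots> = ft v w"
      unfolding ft_def[OF v v1 v2] by (rule integral_completion) measurable
    finally show "fourier u w = ft v w" .
  qed
  note P = plancherel_lborel[OF v v1 v2] and [measurable] = ft_measurable[OF v v1 v2]
  show "sq_integrable lebesgue (fourier u)"
    unfolding eq using P(1) by (simp add: sq_integrable_def integrable_completion measurable_completion)
  have "l2norm lebesgue (ft v) = l2norm lborel (ft v)"
    unfolding l2norm_def by (subst integral_completion) auto
  also have "\<dots> = l2norm lborel v" by (rule P)
  also have "\<dots> = l2norm lebesgue v"
    unfolding l2norm_def by (subst integral_completion) auto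
  also have "\<dots> = l2norm lebesgue u"
    by (rule l2norm_cong_AE[OF ae um vm, symmetric])
  finally show "l2norm lebesgue (fourier u) = l2norm lebesgue u"
    unfolding eq .
qed

section \<open>The Fourier transform on L2\<close>

lemma L2_space_iff: "f \<in> L2_space \<longleftrightarrow> sq_integrable lebesgue f"
  by (simp add: L2_space_def sq_integrable_def)

lemma L2_norm_eq: "L2_norm f = l2norm lebesgue f"
  by (simp add: L2_norm_def l2norm_def)

lemma L1_space_iff: "f \<in> L1_space \<longleftrightarrow> integrable lebesgue f"
  by (simp add: L1_space_def)

section \<open>The transform of sums of translates\<close>

lemma phase_inner_measurable [measurable]: "(\<lambda>x. phase (x \<bullet> w)) \<in> borel_measurable lebesgue"
  by (rule measurable_completion) measurable

lemma phase_inner_measurable' [measurable]: "(\<lambda>x. phase (w \<bullet> x)) \<in> borel_measurable lebesgue"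
  by (rule measurable_completion) measurable

lemma integrable_mult_phase:
  assumes "integrable lebesgue f" shows "integrable lebesgue (\<lambda>x. f x * phase (x \<bullet> w))"
proof (rule Bochner_Integration.integrable_bound[OF assms])
  show "(\<lambda>x. f x * phase (x \<bullet> w)) \<in> borel_measurable lebesgue"
    by (intro borel_measurable_times phase_inner_measurable borel_measurable_integrable assms)
qed (simp add: norm_mult)

lemma fourier_diff:
  assumes "integrable lebesgue f" "integrable lebesgue g"
  shows "fourier (\<lambda>x. f x - g x) w = fourier f w - fourier g w"
  using integrable_mult_phase[OF assms(1)] integrable_mult_phase[OF assms(2)]
  by (simp add: fourier_phase left_diff_distrib)

lemma fourier_translate:
  assumes "f \<in> borel_measurable lebesgue"
  shows "fourier (translate a f) w = phase (a \<bullet> w) * fourier f w"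
proof -
  have m: "(\<lambda>x. f x * phase (x \<bullet> w)) \<in> borel_measurable lebesgue"
    by (intro borel_measurable_times phase_inner_measurable assms)
  have "fourier (translate a f) w =
      (LINT x|lebesgue. phase (a \<bullet> w) * (f (x - a) * phase ((x - a) \<bullet> w)))"
    unfolding fourier_phase translate_def
    by (intro Bochner_Integration.integral_cong refl)
      (simp add: inner_diff_left flip: phase_add mult.assoc mult.left_commute[of "f _"])
  then show ?thesis
    using lebesgue_integral_shift[OF m, of a] by (simp add: fourier_phase)
qed

lemma integrable_translate:
  assumes "integrable lebesgue f" shows "integrable lebesgue (translate a f)"
  unfolding translate_def using assms by (subst lebesgue_integrable_shift_iff) auto

lemma fourier_sum_translates:
  assumes f: "integrable lebesgue f"
  shows "fourier (\<lambda>x. \<Sum>k\<in>K. c k * translate (a k) f x) w = (\<Sum>k\<in>K. c k * phase (a k \<bullet> w)) * fourier f w"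
proof -
  have "fourier (\<lambda>x. \<Sum>k\<in>K. c k * translate (a k) f x) w =
      (LINT x|lebesgue. (\<Sum>k\<in>K. c k * (translate (a k) f x * phase (x \<bullet> w))))"
    by (simp add: fourier_phase sum_distrib_right mult.assoc)
  also have "\<dots> = (\<Sum>k\<in>K. c k * fourier (translate (a k) f) w)"
    unfolding fourier_phase
    by (subst Bochner_Integration.integral_sum)
      (auto intro!: integrable_mult_right integrable_mult_phase integrable_translate f)
  also have "\<dots> = (\<Sum>k\<in>K. c k * phase (a k \<bullet> w)) * fourier f w"
    using f by (simp add: fourier_translate sum_distrib_right mult.assoc)
  finally show ?thesis .
qed

text \<open>Makes the choice in \<open>fourier_L2\<close> meaningful. Truncations of
  \<open>f\<close> lie in L1 and L2 and converge to \<open>f\<close>; by Plancherel their transforms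
  form a Cauchy sequence, and completeness gives \<open>g\<close>.\<close>

theorem is_fourier_L2_exists:
  assumes f: "sq_integrable lebesgue f"
  shows "\<exists>g. is_fourier_L2 f g"
proof -
  \<comment> \<open>The factor 1/4 leaves room for the triangle inequality through \<open>f\<close>:
    consecutive approximants differ by at most \<open>(1/8 + 1/4) * (1/2)^n\<close>, within the rate
    that \<open>l2_fast_Cauchy_limit\<close> asks for.\<close>
  have "\<exists>b. integrable lebesgue b \<and> sq_integrable lebesgue b \<and>
      l2norm lebesgue (\<lambda>x. b x - f x) < (1/2)^n / 4" for n :: nat
  proof -
    obtain b M r where b: "b \<in> borel_measurable lebesgue" "0 < M" "\<And>x. cmod (b x) \<le> M"
      "\<And>x. r < norm x \<Longrightarrow> b x = 0" "sq_integrable lebesgue b"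
      "l2norm lebesgue (\<lambda>x. b x - f x) < (1/2)^n / 4"
      using l2_approx_bounded_support[OF f, of "(1/2)^n / 4"] by auto
    have "integrable lebesgue b"
    proof (rule Bochner_Integration.integrable_bound)
      show "integrable lebesgue (\<lambda>x. M * indicator (cball 0 r) x)"
        by (rule integrable_indicator_cball)
      show "AE x in lebesgue. norm (b x) \<le> norm (M * indicator (cball 0 r) x)"
        using b by (intro AE_I2) (auto simp: indicator_def not_le)
    qed (rule b)
    then show ?thesis using b by auto
  qed
  then obtain u where u: "\<And>n. integrable lebesgue (u n)" "\<And>n. sq_integrable lebesgue (u n)"
    "\<And>n. l2norm lebesgue (\<lambda>x. u n x - f x) < (1/2)^n / 4"
    by metis
  have fast: "l2norm lebesgue (\<lambda>w. fourier (u (Suc n)) w - fourier (u n) w) \<le> (1/2)^n" for n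
  proof -
    have fd: "fourier (\<lambda>x. u (Suc n) x - u n x) = (\<lambda>w. fourier (u (Suc n)) w - fourier (u n) w)"
      by (rule ext) (rule fourier_diff[OF u(1) u(1)])
    have "l2norm lebesgue (\<lambda>w. fourier (u (Suc n)) w - fourier (u n) w) =
        l2norm lebesgue (\<lambda>x. u (Suc n) x - u n x)"
      using plancherel_L1_L2(2)[of "\<lambda>x. u (Suc n) x - u n x"] u
      by (simp add: fd sq_integrable_diff)
    also have "\<dots> \<le> l2norm lebesgue (\<lambda>x. u (Suc n) x - f x) + l2norm lebesgue (\<lambda>x. f x - u n x)"
      by (intro l2norm_triangle_diff u f)
    also have "\<dots> \<le> (1/2)^(Suc n) / 4 + (1/2)^n / 4"
      using u(3)[of "Suc n"] u(3)[of n] l2norm_minus_commute[of lebesgue f "u n"] by simp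
    also have "\<dots> \<le> (1/2)^n" by simp
    finally show ?thesis .
  qed
  obtain g where g: "sq_integrable lebesgue g"
    "(\<lambda>n. l2norm lebesgue (\<lambda>x. fourier (u n) x - g x)) \<longlonglongrightarrow> 0"
    using l2_fast_Cauchy_limit[of lebesgue "\<lambda>n. fourier (u n)", OF plancherel_L1_L2(1) fast] u by blast
  have "(\<lambda>n. l2norm lebesgue (\<lambda>x. u n x - f x)) \<longlonglongrightarrow> 0"
  proof (rule tendsto_sandwich[OF _ _ tendsto_const])
    show "(\<lambda>n. (1/2::real)^n) \<longlonglongrightarrow> 0"
      by (rule LIMSEQ_power_zero) simp
    have "l2norm lebesgue (\<lambda>x. u n x - f x) \<le> (1/2)^n" for n
    proof -
      have "(1/2)^n / 4 \<le> (1/2::real)^n" by simp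
      then show ?thesis using u(3)[of n] by linarith
    qed
    then show "\<forall>\<^sub>F n in sequentially. l2norm lebesgue (\<lambda>x. u n x - f x) \<le> (1/2)^n"
      by simp
  qed simp
  then show ?thesis
    using f g u plancherel_L1_L2(1) unfolding is_fourier_L2_def L2_norm_eq
    by (intro exI[of _ g] conjI exI[of _ u]) (auto simp: L2_space_iff L1_space_iff)
qed

text \<open>For functions in L1 and L2 this is Plancherel applied to the sum, as translation
  multiplies the transform by a phase. Both sides are continuous in L2, so the identity passes to
  the limit along the sequence that witnesses \<open>is_fourier_L2 f g\<close>.\<close>

theorem l2norm_sum_translates:
  fixes f g :: "'a::euclidean_space \<Rightarrow> complex"
  assumes "is_fourier_L2 f g"
  shows "l2norm lebesgue (\<lambda>x. \<Sum>k\<in>K. c k * translate (a k) f x) =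
    l2norm lebesgue (\<lambda>w. (\<Sum>k\<in>K. c k * phase (a k \<bullet> w)) * g w)"
proof -
  define T where "T = (\<lambda>f x. \<Sum>k\<in>K. c k * translate (a k) f x :: complex)"
  define P where "P = (\<lambda>w. \<Sum>k\<in>K. c k * phase (a k \<bullet> w))"
  \<comment> \<open>A common operator bound for \<open>T\<close> and for multiplication by
    \<open>P\<close>: translation preserves the norm and \<open>phase\<close> has modulus 1.\<close>
  define C where "C = (\<Sum>k\<in>K. cmod (c k))"
  have C: "0 \<le> C" by (simp add: C_def sum_nonneg)
  obtain u where f: "sq_integrable lebesgue f" and g: "sq_integrable lebesgue g"
    and u: "\<And>n. integrable lebesgue (u n)" "\<And>n. sq_integrable lebesgue (u n)"
    and uf: "(\<lambda>n. l2norm lebesgue (\<lambda>x. u n x - f x)) \<longlonglongrightarrow> 0"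
    and ug: "(\<lambda>n. l2norm lebesgue (\<lambda>w. fourier (u n) w - g w)) \<longlonglongrightarrow> 0"
    using assms unfolding is_fourier_L2_def L2_norm_eq by (auto simp: L2_space_iff L1_space_iff)
  have Pm: "P \<in> borel_measurable lebesgue"
    unfolding P_def by (intro borel_measurable_sum borel_measurable_times borel_measurable_const phase_inner_measurable')
  have P_le: "cmod (P w) \<le> C" for w
    unfolding P_def C_def by (rule order_trans[OF norm_sum]) (simp add: norm_mult)
  have T_sq: "sq_integrable lebesgue (T h)" if "sq_integrable lebesgue h" for h
    unfolding T_def by (intro sq_integrable_sum sq_integrable_cmult sq_integrable_translate that)
  have Pmult: "sq_integrable lebesgue (\<lambda>w. P w * h w)" "l2norm lebesgue (\<lambda>w. P w * h w) \<le> C * l2norm lebesgue h"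
    if h: "sq_integrable lebesgue h" for h
  proof -
    have m: "(\<lambda>w. P w * h w) \<in> borel_measurable lebesgue"
      using Pm h by (intro borel_measurable_times) auto
    have b: "AE w in lebesgue. cmod (P w * h w) \<le> C * cmod (h w)"
      using P_le by (intro AE_I2) (simp add: norm_mult mult_right_mono)
    show "sq_integrable lebesgue (\<lambda>w. P w * h w)" by (rule sq_integrable_mono[OF h m b])
    show "l2norm lebesgue (\<lambda>w. P w * h w) \<le> C * l2norm lebesgue h" by (rule l2norm_mono[OF h m C b])
  qed
  have T_le: "l2norm lebesgue (T h) \<le> C * l2norm lebesgue h" if h: "sq_integrable lebesgue h" for h
  proof -
    have "l2norm lebesgue (T h) \<le> (\<Sum>k\<in>K. l2norm lebesgue (\<lambda>x. c k * translate (a k) h x))"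
      unfolding T_def by (intro l2norm_sum_le sq_integrable_cmult sq_integrable_translate h)
    also have "\<dots> = C * l2norm lebesgue h"
      using h by (simp add: l2norm_cmult l2norm_translate sq_integrable_measurable C_def sum_distrib_right)
    finally show ?thesis .
  qed
  have T_diff: "T (\<lambda>x. h x - h' x) x = T h x - T h' x" for h h' x
    by (simp add: T_def translate_def right_diff_distrib sum_subtractf)
  have "(\<lambda>n. l2norm lebesgue (\<lambda>x. T (u n) x - T f x)) \<longlonglongrightarrow> 0"
  proof (rule tendsto_sandwich[OF _ _ tendsto_const])
    show "(\<lambda>n. C * l2norm lebesgue (\<lambda>x. u n x - f x)) \<longlonglongrightarrow> 0"
      by (rule tendsto_mult_right_zero[OF uf])
    show "\<forall>\<^sub>F n in sequentially. l2norm lebesgue (\<lambda>x. T (u n) x - T f x)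
        \<le> C * l2norm lebesgue (\<lambda>x. u n x - f x)"
      using T_le[OF sq_integrable_diff[OF u(2) f]] by (simp add: T_diff[abs_def])
  qed simp
  then have 1: "(\<lambda>n. l2norm lebesgue (T (u n))) \<longlonglongrightarrow> l2norm lebesgue (T f)"
    by (rule l2norm_tendsto[where u = "\<lambda>n. T (u n)", OF T_sq[OF u(2)] T_sq[OF f]])
  have fu: "sq_integrable lebesgue (fourier (u n))" for n
    by (rule plancherel_L1_L2(1)[OF u])
  have "(\<lambda>n. l2norm lebesgue (\<lambda>w. P w * fourier (u n) w - P w * g w)) \<longlonglongrightarrow> 0"
  proof (rule tendsto_sandwich[OF _ _ tendsto_const])
    show "(\<lambda>n. C * l2norm lebesgue (\<lambda>w. fourier (u n) w - g w)) \<longlonglongrightarrow> 0"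
      by (rule tendsto_mult_right_zero[OF ug])
    show "\<forall>\<^sub>F n in sequentially. l2norm lebesgue (\<lambda>w. P w * fourier (u n) w - P w * g w)
        \<le> C * l2norm lebesgue (\<lambda>w. fourier (u n) w - g w)"
      using Pmult(2)[OF sq_integrable_diff[OF fu g]] by (simp add: right_diff_distrib)
  qed simp
  then have 2: "(\<lambda>n. l2norm lebesgue (\<lambda>w. P w * fourier (u n) w)) \<longlonglongrightarrow> l2norm lebesgue (\<lambda>w. P w * g w)"
    by (rule l2norm_tendsto[where u = "\<lambda>n w. P w * fourier (u n) w", OF Pmult(1)[OF fu] Pmult(1)[OF g]])
  have "l2norm lebesgue (T (u n)) = l2norm lebesgue (\<lambda>w. P w * fourier (u n) w)" for n
  proof -
    have "integrable lebesgue (T (u n))"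
      unfolding T_def
      by (intro Bochner_Integration.integrable_sum integrable_mult_right integrable_translate u)
    moreover have "fourier (T (u n)) = (\<lambda>w. P w * fourier (u n) w)"
      unfolding T_def P_def by (rule ext) (rule fourier_sum_translates[OF u(1)])
    ultimately show ?thesis
      using plancherel_L1_L2(2)[OF _ T_sq[OF u(2)]] by metis
  qed
  then show ?thesis
    using LIMSEQ_unique[OF 1] 2 unfolding T_def P_def by simp
qed

section \<open>The Gram matrix\<close>

text \<open>The squared modulus of the trigonometric polynomial is a double sum of characters at the
  differences \<open>a j - a k\<close>; integrating them against the squared modulus of
  \<open>g\<close> produces values of its transform.\<close>

lemma l2norm_sum_translates_gram:
  fixes f g :: "'a::euclidean_space \<Rightarrow> complex"
  assumes "is_fourier_L2 f g"
  shows "complex_of_real ((l2norm lebesgue (\<lambda>x. \<Sum>k\<in>K. c k * translate (a k) f x))\<^sup>2) =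
    (\<Sum>j\<in>K. \<Sum>k\<in>K. c j * cnj (c k) * fourier (\<lambda>w. complex_of_real ((cmod (g w))\<^sup>2)) (a j - a k))"
proof -
  let ?\<Phi> = "\<lambda>w. complex_of_real ((cmod (g w))\<^sup>2)"
  let ?P = "\<lambda>w. \<Sum>k\<in>K. c k * phase (a k \<bullet> w)"
  have "sq_integrable lebesgue g"
    using assms by (simp add: is_fourier_L2_def L2_space_iff)
  then have \<Phi>: "integrable lebesgue ?\<Phi>"
    by (intro integrable_of_real) (simp add: sq_integrable_def)
  have "complex_of_real ((l2norm lebesgue (\<lambda>x. \<Sum>k\<in>K. c k * translate (a k) f x))\<^sup>2) =
      (LINT w|lebesgue. complex_of_real ((cmod (?P w * g w))\<^sup>2))"
    by (simp only: l2norm_sum_translates[OF assms] l2norm_power2 integral_complex_of_real)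
  also have "\<dots> = (LINT w|lebesgue. (\<Sum>j\<in>K. \<Sum>k\<in>K. c j * cnj (c k) * (?\<Phi> w * phase (w \<bullet> (a j - a k)))))"
  proof (intro Bochner_Integration.integral_cong refl)
    fix w
    have "complex_of_real ((cmod (?P w * g w))\<^sup>2) = (?P w * cnj (?P w)) * ?\<Phi> w"
      by (simp only: norm_mult power_mult_distrib of_real_mult complex_norm_square)
    also have "?P w * cnj (?P w) =
        (\<Sum>j\<in>K. \<Sum>k\<in>K. c j * phase (a j \<bullet> w) * cnj (c k * phase (a k \<bullet> w)))"
      by (simp only: cnj_sum sum_product)
    also have "\<dots> = (\<Sum>j\<in>K. \<Sum>k\<in>K. c j * cnj (c k) * phase (w \<bullet> (a j - a k)))"
      by (intro sum.cong refl) (simp add: inner_diff_right phase_diff inner_commute[of w] mult_ac)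
    also have "\<dots> * ?\<Phi> w = (\<Sum>j\<in>K. \<Sum>k\<in>K. c j * cnj (c k) * (?\<Phi> w * phase (w \<bullet> (a j - a k))))"
      by (simp add: sum_distrib_left sum_distrib_right mult_ac)
    finally show "complex_of_real ((cmod (?P w * g w))\<^sup>2) =
        (\<Sum>j\<in>K. \<Sum>k\<in>K. c j * cnj (c k) * (?\<Phi> w * phase (w \<bullet> (a j - a k))))" .
  qed
  also have "\<dots> = (\<Sum>j\<in>K. LINT w|lebesgue. (\<Sum>k\<in>K. c j * cnj (c k) * (?\<Phi> w * phase (w \<bullet> (a j - a k)))))"
    by (intro Bochner_Integration.integral_sum Bochner_Integration.integrable_sum
        integrable_mult_right integrable_mult_phase \<Phi>)
  also have "\<dots> = (\<Sum>j\<in>K. \<Sum>k\<in>K. LINT w|lebesgue. c j * cnj (c k) * (?\<Phi> w * phase (w \<bullet> (a j - a k))))"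
    by (intro sum.cong refl Bochner_Integration.integral_sum integrable_mult_right integrable_mult_phase \<Phi>)
  also have "\<dots> = (\<Sum>j\<in>K. \<Sum>k\<in>K. c j * cnj (c k) * fourier ?\<Phi> (a j - a k))"
    by (simp only: integral_mult_right_zero fourier_phase)
  finally show ?thesis .
qed

text \<open>For a real function, reflecting the frequency conjugates the transform. This makes the
  moduli of the Gram entries symmetric.\<close>

lemma cmod_fourier_real_minus:
  "cmod (fourier (\<lambda>x. complex_of_real (h x)) (- w)) = cmod (fourier (\<lambda>x. complex_of_real (h x)) w)"
proof -
  have "fourier (\<lambda>x. complex_of_real (h x)) (- w) =
      (LINT x|lebesgue. cnj (complex_of_real (h x) * phase (x \<bullet> w)))"
    by (simp add: fourier_phase cnj_phase del: Bochner_Integration.integral_cnj)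
  then have "fourier (\<lambda>x. complex_of_real (h x)) (- w) = cnj (fourier (\<lambda>x. complex_of_real (h x)) w)"
    by (simp only: Bochner_Integration.integral_cnj fourier_phase)
  then show ?thesis by simp
qed

text \<open>A Schur test off the diagonal: the arithmetic-geometric mean inequality splits each term
  into one part for row \<open>j\<close> and one for row \<open>k\<close>, and by symmetry both
  parts add up to the same row sums. Bounding the distance from the diagonal form gives the lower
  and the upper Riesz bound at once.\<close>

lemma diagonally_dominant_form_bound:
  fixes G :: "'i \<Rightarrow> 'i \<Rightarrow> complex"
  assumes K: "finite K" and diag: "\<And>k. G k k = of_real N"
    and sym: "\<And>j k. cmod (G j k) = cmod (G k j)"
    and row: "\<And>j. (\<Sum>k\<in>K - {j}. cmod (G j k)) \<le> S"
  shows "cmod ((\<Sum>j\<in>K. \<Sum>k\<in>K. c j * cnj (c k) * G j k) - of_real (N * (\<Sum>k\<in>K. (cmod (c k))\<^sup>2)))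
    \<le> S * (\<Sum>k\<in>K. (cmod (c k))\<^sup>2)"
proof -
  let ?p = "\<lambda>j k. (cmod (c j))\<^sup>2 * cmod (G j k)"
  have split: "(\<Sum>k\<in>K. h k) = h j + (\<Sum>k\<in>K - {j}. h k)" if "j \<in> K" for j and h :: "'i \<Rightarrow> complex"
    by (rule sum.remove[OF K that])
  have "(\<Sum>j\<in>K. \<Sum>k\<in>K. c j * cnj (c k) * G j k) =
      (\<Sum>j\<in>K. of_real (N * (cmod (c j))\<^sup>2) + (\<Sum>k\<in>K - {j}. c j * cnj (c k) * G j k))"
  proof (intro sum.cong refl)
    fix j assume "j \<in> K"
    have "c j * cnj (c j) * G j j = of_real (N * (cmod (c j))\<^sup>2)"
      by (simp only: diag of_real_mult complex_norm_square mult_ac)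
    then show "(\<Sum>k\<in>K. c j * cnj (c k) * G j k) =
        of_real (N * (cmod (c j))\<^sup>2) + (\<Sum>k\<in>K - {j}. c j * cnj (c k) * G j k)"
      using split[OF \<open>j \<in> K\<close>, of "\<lambda>k. c j * cnj (c k) * G j k"] by simp
  qed
  then have "(\<Sum>j\<in>K. \<Sum>k\<in>K. c j * cnj (c k) * G j k) - of_real (N * (\<Sum>k\<in>K. (cmod (c k))\<^sup>2)) =
      (\<Sum>j\<in>K. \<Sum>k\<in>K - {j}. c j * cnj (c k) * G j k)"
    by (simp add: sum.distrib sum_distrib_left)
  also have "cmod \<dots> \<le> (\<Sum>j\<in>K. \<Sum>k\<in>K - {j}. cmod (c j) * cmod (c k) * cmod (G j k))"
    by (intro order_trans[OF norm_sum] sum_mono) (simp add: norm_mult)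
  also have "\<dots> \<le> (\<Sum>j\<in>K. \<Sum>k\<in>K - {j}. (?p j k + ?p k j) / 2)"
  proof (intro sum_mono)
    fix j k
    have "cmod (c j) * cmod (c k) \<le> ((cmod (c j))\<^sup>2 + (cmod (c k))\<^sup>2) / 2"
      using zero_le_power2[of "cmod (c j) - cmod (c k)"] by (simp add: power2_diff)
    then have "cmod (c j) * cmod (c k) * cmod (G j k)
        \<le> ((cmod (c j))\<^sup>2 + (cmod (c k))\<^sup>2) / 2 * cmod (G j k)"
      by (rule mult_right_mono) simp
    then show "cmod (c j) * cmod (c k) * cmod (G j k) \<le> (?p j k + ?p k j) / 2"
      by (simp add: sym[of k j] algebra_simps add_divide_distrib)
  qed
  also have "\<dots> = (\<Sum>j\<in>K. \<Sum>k\<in>K - {j}. ?p j k)"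
  proof -
    have swap: "(\<Sum>j\<in>K. \<Sum>k\<in>K - {j}. ?p k j) = (\<Sum>j\<in>K. \<Sum>k\<in>K - {j}. ?p j k)"
    proof -
      \<comment> \<open>The range \<open>K - {j}\<close> depends on \<open>j\<close>; as a
        conditional summand over \<open>K\<close> it permits the interchange of sums.\<close>
      have off: "(\<Sum>k\<in>K - {j}. h k) = (\<Sum>k\<in>K. if k = j then 0 else h k)" for j and h :: "'i \<Rightarrow> real"
        using K by (auto simp: if_distrib sum.If_cases Diff_eq Compl_eq intro!: sum.mono_neutral_cong_left)
      show ?thesis
        unfolding off by (subst sum.swap) (intro sum.cong refl, auto)
    qed
    show ?thesis
      by (simp add: sum.distrib swap flip: sum_divide_distrib)
  qed
  also have "\<dots> \<le> (\<Sum>j\<in>K. (cmod (c j))\<^sup>2 * S)"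
    unfolding sum_distrib_left[symmetric] by (intro sum_mono mult_left_mono row) simp
  also have "\<dots> = S * (\<Sum>k\<in>K. (cmod (c k))\<^sup>2)"
    by (simp add: sum_distrib_left mult.commute)
  finally show ?thesis .
qed

theorem proposition4p4:
  fixes \<phi> :: "real ^ 'd \<Rightarrow> complex"
    and \<Phi> :: "real ^ 'd \<Rightarrow> real"
    and lam :: "int \<Rightarrow> real ^ 'd"
  assumes "\<phi> \<in> L2_space"
    and "\<not> (AE x in lebesgue. \<phi> x = 0)"
    and "\<And>w. \<Phi> w = (cmod (fourier_L2 \<phi> w))\<^sup>2"
    and "ennreal ((L2_norm \<phi>)\<^sup>2) >
      (SUP j. \<Sum>\<^sub>\<infinity>l\<in>{l. l \<noteq> j}.
         ennreal (cmod (fourier (\<lambda>w. complex_of_real (\<Phi> w)) (lam j - lam l))))"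
  shows "riesz_sequence (\<lambda>k. translate (lam k) \<phi>)"
proof -
  define N where "N = (L2_norm \<phi>)\<^sup>2"
  define G where "G = (\<lambda>j k. fourier (\<lambda>w. complex_of_real (\<Phi> w)) (lam j - lam k))"
  have \<phi>: "sq_integrable lebesgue \<phi>"
    using assms(1) by (simp add: L2_space_iff)
  have ft: "is_fourier_L2 \<phi> (fourier_L2 \<phi>)"
    unfolding fourier_L2_def using is_fourier_L2_exists[OF \<phi>] by (rule someI_ex)
  have \<Phi>: "\<Phi> = (\<lambda>w. (cmod (fourier_L2 \<phi> w))\<^sup>2)"
    using assms(3) by auto
  have gram: "complex_of_real ((L2_norm (\<lambda>x. \<Sum>k\<in>K. c k * translate (lam k) \<phi> x))\<^sup>2) =
      (\<Sum>j\<in>K. \<Sum>k\<in>K. c j * cnj (c k) * G j k)" for K c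
    unfolding G_def \<Phi> L2_norm_eq by (rule l2norm_sum_translates_gram[OF ft])
  \<comment> \<open>The Gram identity for a single translate with coefficient 1, whose norm is that
    of \<phi>.\<close>
  have diag: "G k k = of_real N" for k
    using gram[of "\<lambda>_. 1" "{k}"] \<phi>
    by (simp add: N_def L2_norm_eq l2norm_translate sq_integrable_measurable)
  have sym: "cmod (G j k) = cmod (G k j)" for j k
    using cmod_fourier_real_minus[of \<Phi> "lam k - lam j"] by (simp add: G_def)
  define s where "s = (SUP j. \<Sum>\<^sub>\<infinity>l\<in>{l. l \<noteq> j}. ennreal (cmod (G j l)))"
  have s: "s < ennreal N"
    using assms(4) by (simp add: s_def G_def N_def)
  \<comment> \<open>Being below a finite value, the supremum is a real number, and the gap
    \<open>N - S\<close> is the same for all \<open>K\<close>.\<close>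
  then obtain S where S: "s = ennreal S" "0 \<le> S" "S < N"
    by (cases s) (auto simp: ennreal_less_iff)
  have row: "(\<Sum>k\<in>K - {j}. cmod (G j k)) \<le> S" if "finite K" for K j
  proof -
    have "ennreal (\<Sum>k\<in>K - {j}. cmod (G j k)) = (\<Sum>k\<in>K - {j}. ennreal (cmod (G j k)))"
      by (rule sum_ennreal[symmetric]) simp
    \<comment> \<open>In \<open>ennreal\<close> the infinite sum is the supremum of its finite
      partial sums.\<close>
    also have "\<dots> \<le> (\<Sum>\<^sub>\<infinity>l\<in>{l. l \<noteq> j}. ennreal (cmod (G j l)))"
      using that by (subst nonneg_infsum_complete) (auto intro!: SUP_upper)
    also have "\<dots> \<le> ennreal S"
      unfolding S(1)[symmetric] s_def by (rule SUP_upper) simp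
    finally show ?thesis using S(2) by (simp add: ennreal_le_iff)
  qed
  have bound: "\<bar>(L2_norm (\<lambda>x. \<Sum>k\<in>K. c k * translate (lam k) \<phi> x))\<^sup>2 - N * (\<Sum>k\<in>K. (cmod (c k))\<^sup>2)\<bar>
      \<le> S * (\<Sum>k\<in>K. (cmod (c k))\<^sup>2)" if "finite K" for K c
    \<comment> \<open>The Gram form is a squared norm, hence real, so the modulus becomes an
      absolute value.\<close>
    using diagonally_dominant_form_bound[OF that diag sym row[OF that], of c]
    unfolding gram[symmetric] of_real_diff[symmetric] norm_of_real .
  show ?thesis
    unfolding riesz_sequence_def
  proof (rule conjI[OF allI])
    show "translate (lam k) \<phi> \<in> L2_space" for k
      using sq_integrable_translate[OF \<phi>] by (simp add: L2_space_iff)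
    have "(N - S) * (\<Sum>k\<in>K. (cmod (c k))\<^sup>2) \<le> (L2_norm (\<lambda>x. \<Sum>k\<in>K. c k * translate (lam k) \<phi> x))\<^sup>2 \<and>
        (L2_norm (\<lambda>x. \<Sum>k\<in>K. c k * translate (lam k) \<phi> x))\<^sup>2 \<le> (N + S) * (\<Sum>k\<in>K. (cmod (c k))\<^sup>2)"
      if "finite K" for K c
      using bound[OF that, of c] by (simp add: algebra_simps abs_le_iff)
    moreover have "0 < N - S" "N - S \<le> N + S" using S by auto
    ultimately show "\<exists>A B. 0 < A \<and> A \<le> B \<and> (\<forall>K c. finite K \<longrightarrow>
        A * (\<Sum>k\<in>K. (cmod (c k))\<^sup>2) \<le> (L2_norm (\<lambda>x. \<Sum>k\<in>K. c k * translate (lam k) \<phi> x))\<^sup>2 \<and>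
        (L2_norm (\<lambda>x. \<Sum>k\<in>K. c k * translate (lam k) \<phi> x))\<^sup>2 \<le> B * (\<Sum>k\<in>K. (cmod (c k))\<^sup>2))"
      by blast
  qed
qed

end
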